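(* Let $n\ge 2$, let $\Omega\in L^1(S^{n-1})$ be positively homogeneous of degree $0$, let $1<p<\infty$, $1/p+1/p'=1$, $h\in\mathcal H(p')$ and $f\in L^p(\mathbb R^n)$. For $\epsilon>0$ define $$T_\epsilon f(x)=\int_{|y|>\epsilon}\frac{\Omega(y)}{|y|^n}\,h(|y|)\,f(x-y)\,dy$$ and, for $t>0$, $$A_{\epsilon,t}f(x)=\frac1{t^n}\int_{tS\setminus B(0,\epsilon)}f(x-y)\,h(|y|)\,\operatorname{sgn}\Omega(y)\,dy, \qquad (1)$$ where $S=S_\Omega$ is the star-shaped set associated with $\Omega$. Then for almost all $x\in\mathbb R^n$ $$T_\epsilon f(x)=n\int_0^\infty A_{\epsilon,t}f(x)\,\frac{dt}{t}, \qquad (2)$$ and the integrals in (1) and (2) converge absolutely. Moreover, if $f\in L^\infty(\mathbb R^n)$ has compact support and $h\in\mathcal H(1)$, then (2) holds for all $x\in\mathbb R^n$ and the integrals in (1) and (2) converge absolutely for all $x\in\mathbb R^n$.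
   Context: $S^{n-1}$ is the unit sphere of $\mathbb R^n$ with surface measure. A function $\Omega$ that is positively homogeneous of degree $0$ ($\Omega(tx)=\Omega(x)$ for $t>0$, $x\ne0$) is identified with its restriction to $S^{n-1}$. For $z\in\mathbb C$, $\operatorname{sgn}z=z/|z|$ if $z\neq0$ and $\operatorname{sgn}0=0$. The star-shaped set associated with $\Omega$ is $S_\Omega=\{x\in\mathbb R^n: |x|\le\rho_\Omega(x)\}$, where $\rho_\Omega(x)=|\Omega(x)|^{1/n}$; $tS=\{tx:x\in S\}$. For $1\le\sigma<\infty$, $\mathcal H(\sigma)$ is the class of measurable complex-valued functions $h$ on $(0,\infty)$ for which there is $C_h>0$ with $\int_R^{2R}|h(r)|^\sigma\,dr\le C_hR$ for all $R>0$. *)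

theory Defs
  imports "HOL-Analysis.Analysis"
begin

text \<open>
  Surface measure on the unit sphere, via its standard description through cones:
  a Borel set \<open>E\<close> of unit vectors has surface measure \<open>n\<close> times the Lebesgue measure of
  \<open>{r e | e \<in> E, 0 < r < 1}\<close> (lemma \<open>emeasure_sphere_measure\<close>).  The factor \<open>n\<close> is the usual
  normalisation, for which \<open>dx = r^(n-1) dr d\<sigma>\<close> in polar coordinates.
\<close>

definition sphere_measure :: "(real^'n) measure" where
  "sphere_measure =
     scale_measure (of_nat CARD('n))
       (distr (restrict_space lborel (ball 0 1 - {0}))
              (restrict_space borel (sphere 0 1))
              (\<lambda>x. x /\<^sub>R norm x))"

lemma measurable_sphere_projection:
  "(\<lambda>x. x /\<^sub>R norm x) \<in> restrict_space lborel (ball 0 1 - {0::real^'n})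
      \<rightarrow>\<^sub>M restrict_space borel (sphere 0 1)"
  by (intro measurable_restrict_space3) auto

lemma space_sphere_measure: "space (sphere_measure :: (real^'n) measure) = sphere 0 1"
  by (simp add: sphere_measure_def space_scale_measure space_restrict_space)

lemma emeasure_sphere_measure:
  fixes E :: "(real^'n) set"
  assumes E: "E \<in> sets borel" "E \<subseteq> sphere 0 1"
  shows "emeasure sphere_measure E =
           of_nat CARD('n) * emeasure lborel {r *\<^sub>R e | r e. e \<in> E \<and> 0 < r \<and> r < 1}"
proof -
  let ?D = "ball 0 1 - {0::real^'n}"
  let ?p = "\<lambda>x::real^'n. x /\<^sub>R norm x"
  have E': "E \<in> sets (restrict_space borel (sphere 0 1))"
    using E by (auto simp: sets_restrict_space_iff)
  have eq: "?p -` E \<inter> ?D = {r *\<^sub>R e | r e. e \<in> E \<and> 0 < r \<and> r < 1}"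
  proof (intro set_eqI iffI)
    fix x assume x: "x \<in> ?p -` E \<inter> ?D"
    then have "x = norm x *\<^sub>R ?p x" by simp
    moreover have "?p x \<in> E" "0 < norm x" "norm x < 1" using x by simp_all
    ultimately show "x \<in> {r *\<^sub>R e | r e. e \<in> E \<and> 0 < r \<and> r < 1}" by blast
  next
    fix x assume "x \<in> {r *\<^sub>R e | r e. e \<in> E \<and> 0 < r \<and> r < 1}"
    then obtain r e where re: "x = r *\<^sub>R e" "e \<in> E" "0 < r" "r < 1" by auto
    moreover have e: "norm e = 1" using re E by auto
    ultimately have "norm x = r" "x /\<^sub>R norm x = e" by simp_all
    moreover have "x \<noteq> 0" using calculation(1) re by (metis less_irrefl norm_zero)
    ultimately show "x \<in> ?p -` E \<inter> ?D" using re by (simp del: scaleR_eq_0_iff)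
  qed
  have "emeasure sphere_measure E =
      of_nat CARD('n) * emeasure (restrict_space lborel ?D) (?p -` E \<inter> ?D)"
    unfolding sphere_measure_def emeasure_scale_measure
    using emeasure_distr[OF measurable_sphere_projection E']
    by (simp add: space_restrict_space)
  also have "emeasure (restrict_space lborel ?D) (?p -` E \<inter> ?D) = emeasure lborel (?p -` E \<inter> ?D)"
    by (intro emeasure_restrict_space) auto
  finally show ?thesis unfolding eq .
qed

definition surface_measure :: "(real^'n) measure" where
  "surface_measure = completion sphere_measure"

text \<open>\<open>\<Omega>\<close> is positively homogeneous of degree 0 on all of space; since
  \<open>space surface_measure = sphere 0 1\<close>, integrability only concerns its restriction to the sphere.\<close>

definition pos_homogeneous0 :: "(real^'n \<Rightarrow> complex) \<Rightarrow> bool" where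
  "pos_homogeneous0 \<Omega> \<longleftrightarrow> (\<forall>t x. t > 0 \<longrightarrow> x \<noteq> 0 \<longrightarrow> \<Omega> (t *\<^sub>R x) = \<Omega> x)"

definition Lp_class :: "real \<Rightarrow> (real^'n \<Rightarrow> complex) set" where
  "Lp_class p = {f. f \<in> borel_measurable lebesgue \<and> integrable lebesgue (\<lambda>x. cmod (f x) powr p)}"

definition Linf_class :: "(real^'n \<Rightarrow> complex) set" where
  "Linf_class = {f. f \<in> borel_measurable lebesgue \<and> (\<exists>B. AE x in lebesgue. cmod (f x) \<le> B)}"

text \<open>Support in the sense of measure theory, so that it does not depend on the representative of
  a class of functions that agree almost everywhere.\<close>

definition ess_support :: "(real^'n \<Rightarrow> complex) \<Rightarrow> (real^'n) set" where
  "ess_support f = - \<Union>{U. open U \<and> (AE x in lebesgue. x \<in> U \<longrightarrow> f x = 0)}"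

text \<open>Only the values of \<open>h\<close> on the positive half-line matter.\<close>

definition H_class :: "real \<Rightarrow> (real \<Rightarrow> complex) set" where
  "H_class \<sigma> = {h. h \<in> borel_measurable (lebesgue_on {0<..}) \<and>
     (\<exists>C>0. \<forall>R>0. (\<integral>\<^sup>+ r\<in>{R..2*R}. ennreal (cmod (h r) powr \<sigma>) \<partial>lebesgue) \<le> ennreal (C * R))}"

definition radius_fun :: "(real^'n \<Rightarrow> complex) \<Rightarrow> real^'n \<Rightarrow> real" where
  "radius_fun \<Omega> x = cmod (\<Omega> x) powr (1 / real CARD('n))"

definition star_set :: "(real^'n \<Rightarrow> complex) \<Rightarrow> (real^'n) set" where
  "star_set \<Omega> = {x. norm x \<le> radius_fun \<Omega> x}"

definition T_integrand ::
  "(real^'n \<Rightarrow> complex) \<Rightarrow> (real \<Rightarrow> complex) \<Rightarrow> (real^'n \<Rightarrow> complex) \<Rightarrow> real^'n \<Rightarrow> real^'n \<Rightarrow> complex"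
  where "T_integrand \<Omega> h f x y =
    \<Omega> y / of_real (norm y ^ CARD('n)) * h (norm y) * f (x - y)"

definition T_dom :: "real \<Rightarrow> (real^'n) set" where
  "T_dom \<epsilon> = {y. norm y > \<epsilon>}"

definition T_op ::
  "(real^'n \<Rightarrow> complex) \<Rightarrow> (real \<Rightarrow> complex) \<Rightarrow> real \<Rightarrow> (real^'n \<Rightarrow> complex) \<Rightarrow> real^'n \<Rightarrow> complex"
  where "T_op \<Omega> h \<epsilon> f x = (LINT y:T_dom \<epsilon>|lebesgue. T_integrand \<Omega> h f x y)"

definition A_integrand ::
  "(real^'n \<Rightarrow> complex) \<Rightarrow> (real \<Rightarrow> complex) \<Rightarrow> (real^'n \<Rightarrow> complex) \<Rightarrow> real^'n \<Rightarrow> real^'n \<Rightarrow> complex"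
  where "A_integrand \<Omega> h f x y = f (x - y) * h (norm y) * sgn (\<Omega> y)"

definition A_dom :: "(real^'n \<Rightarrow> complex) \<Rightarrow> real \<Rightarrow> real \<Rightarrow> (real^'n) set" where
  "A_dom \<Omega> \<epsilon> t = (\<lambda>x. t *\<^sub>R x) ` star_set \<Omega> - ball 0 \<epsilon>"

definition A_op ::
  "(real^'n \<Rightarrow> complex) \<Rightarrow> (real \<Rightarrow> complex) \<Rightarrow> real \<Rightarrow> real \<Rightarrow> (real^'n \<Rightarrow> complex) \<Rightarrow> real^'n \<Rightarrow> complex"
  where "A_op \<Omega> h \<epsilon> t f x =
    1 / of_real (t ^ CARD('n)) * (LINT y:A_dom \<Omega> \<epsilon> t|lebesgue. A_integrand \<Omega> h f x y)"

text \<open>Bochner integrability is absolute convergence.  Since the Bochner integral of a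
  non-integrable function is 0 by convention, the existence of the integral defining
  \<open>T_op\<close> has to be claimed along with the identity.\<close>

definition representation_at ::
  "(real^'n \<Rightarrow> complex) \<Rightarrow> (real \<Rightarrow> complex) \<Rightarrow> real \<Rightarrow> (real^'n \<Rightarrow> complex) \<Rightarrow> real^'n \<Rightarrow> bool"
  where "representation_at \<Omega> h \<epsilon> f x \<longleftrightarrow>
    set_integrable lebesgue (T_dom \<epsilon>) (T_integrand \<Omega> h f x) \<and>
    (\<forall>t>0. set_integrable lebesgue (A_dom \<Omega> \<epsilon> t) (A_integrand \<Omega> h f x)) \<and>
    set_integrable lebesgue {0<..} (\<lambda>t. A_op \<Omega> h \<epsilon> t f x / of_real t) \<and>
    T_op \<Omega> h \<epsilon> f x =
      of_nat CARD('n) * (LINT t:{0<..}|lebesgue. A_op \<Omega> h \<epsilon> t f x / of_real t)"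

end

theory Submission
  imports Defs
begin

text \<open>
  For \<open>\<Omega>(y) \<noteq> 0\<close> the point \<open>y\<close> lies in \<open>tS\<close> exactly when \<open>t^n |\<Omega>(y)| / |y|^n \<ge> 1\<close>, and integrating
  \<open>n t^(-n-1)\<close> over these \<open>t\<close> gives \<open>|\<Omega>(y)| / |y|^n\<close>.  Since \<open>\<Omega> = |\<Omega>| sgn \<Omega>\<close>, the identity is Fubini's
  theorem as soon as the integral defining \<open>T\<close> converges absolutely.  On the \<open>t\<close>-superlevel set the
  integrand of \<open>A\<close> is at most \<open>t^n\<close> times that of \<open>T\<close>, so it is integrable for every \<open>t > 0\<close>.

  Absolute convergence follows from Young's inequality
  \<open>|h| |f| \<le> |h|^p' |y|^(1-p') + |f|^p |y|\<close>.  In polar coordinates the first term gives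
  \<open>\<integral> |h(r)|^p' r^(-p') dr\<close> over \<open>r > \<epsilon>\<close>, which is finite by dyadic decomposition.  The second one gives
  \<open>\<integral> |\<Omega>(\<theta>)| \<integral> |f(x - r \<theta>)|^p dr d\<theta>\<close>, which is locally integrable in \<open>x\<close>, because a line meets a
  ball of radius \<open>N\<close> in a set of length \<open>O(N)\<close>.
\<close>

subsection \<open>Polar coordinates\<close>

text \<open>At the origin the value is an arbitrary unit vector, so that \<open>sphere_dir\<close> maps the whole
  space into the sphere.\<close>

definition sphere_dir :: "real^'n \<Rightarrow> real^'n" where
  "sphere_dir y = (if y = 0 then SOME b. b \<in> Basis else y /\<^sub>R norm y)"

lemma norm_sphere_dir [simp]: "norm (sphere_dir y) = 1"
  by (simp add: sphere_dir_def)

lemma sphere_dir_scale [simp]: "norm y *\<^sub>R sphere_dir y = y"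
  by (simp add: sphere_dir_def)

lemma measurable_sphere_dir_borel [measurable]: "sphere_dir \<in> borel \<rightarrow>\<^sub>M borel"
  unfolding sphere_dir_def[abs_def] by measurable

lemma sets_sphere_measure: "sets sphere_measure = sets (restrict_space borel (sphere 0 1))"
  by (simp add: sphere_measure_def)

lemma measurable_sphere_dir [measurable]: "sphere_dir \<in> borel \<rightarrow>\<^sub>M sphere_measure"
  unfolding measurable_cong_sets[OF refl sets_sphere_measure]
  by (intro measurable_restrict_space2) auto

lemma finite_sphere_measure: "finite_measure (sphere_measure :: (real^'n) measure)"
proof
  have "emeasure sphere_measure (sphere 0 1 :: (real^'n) set) =
     of_nat CARD('n) * emeasure lborel {r *\<^sub>R e | r (e::real^'n). e \<in> sphere 0 1 \<and> 0 < r \<and> r < 1}"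
    by (rule emeasure_sphere_measure) auto
  also have "\<dots> \<le> of_nat CARD('n) * emeasure lborel (ball 0 1 :: (real^'n) set)"
    by (intro mult_left_mono emeasure_mono) auto
  also have "\<dots> < \<infinity>"
    using emeasure_lborel_ball_finite[of "0::real^'n" 1]
    by (simp add: ennreal_mult_less_top of_nat_less_top)
  finally show "emeasure sphere_measure (space (sphere_measure :: (real^'n) measure)) \<noteq> \<infinity>"
    by (simp add: space_sphere_measure)
qed

text \<open>The radial factor r^(n-1) dr of Lebesgue measure. It is placed on the whole line,
  without mass on the nonpositive half, so that it can be tested on the half-lines
  \<open>{..<a}\<close>, which generate the Borel sets.\<close>

definition radial_measure :: "nat \<Rightarrow> real measure" where
  "radial_measure n = density lborel (\<lambda>r. ennreal (r ^ (n - 1)) * indicator {0<..} r)"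

lemma emeasure_radial_measure:
  assumes "n > 0"
  shows "emeasure (radial_measure n) {..<a} = (if a > 0 then ennreal (a ^ n / n) else 0)"
proof -
  have "emeasure (radial_measure n) {..<a} =
      (\<integral>\<^sup>+r. ennreal (r ^ (n - 1)) * indicator {0<..} r * indicator {..<a} r \<partial>lborel)"
    unfolding radial_measure_def by (subst emeasure_density) auto
  also have "\<dots> = (if a > 0 then ennreal (a ^ n / n) else 0)"
  proof (cases "a > 0")
    case True
    have "(\<integral>\<^sup>+r. ennreal (r ^ (n - 1)) * indicator {0<..} r * indicator {..<a} r \<partial>lborel) =
        (\<integral>\<^sup>+r. ennreal (r ^ (n - 1)) * indicator {0..a} r \<partial>lborel)"
    proof (rule nn_integral_cong_AE)
      show "AE r in lborel. ennreal (r ^ (n - 1)) * indicator {0<..} r * indicator {..<a} r =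
          ennreal (r ^ (n - 1)) * indicator {0..a} r"
        using AE_lborel_singleton[of 0] AE_lborel_singleton[of a]
        by eventually_elim (auto split: split_indicator)
    qed
    also have "\<dots> = ennreal (a ^ n / n - 0 ^ n / n)"
    proof (rule nn_integral_FTC_Icc)
      fix x :: real
      show "DERIV (\<lambda>r. r ^ n / n) x :> x ^ (n - 1)"
        using DERIV_cdivide[OF DERIV_pow[of n x], of "real n"] assms by simp
    qed (use True in auto)
    finally show ?thesis using True assms by (simp add: zero_power)
  next
    case False
    then show ?thesis
      by (auto simp: nn_integral_0_iff_AE intro!: AE_I2 split: split_indicator)
  qed
  finally show ?thesis .
qed

lemma sigma_finite_radial_measure: "n > 0 \<Longrightarrow> sigma_finite_measure (radial_measure n)"
proof (unfold sigma_finite_measure_def, intro exI[of _ "range (\<lambda>i::nat. {..<real i})"] conjI)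
  show "\<Union> (range (\<lambda>i::nat. {..<real i})) = space (radial_measure n)"
    using reals_Archimedean2 by (auto simp: radial_measure_def)
qed (auto simp: emeasure_radial_measure, auto simp: radial_measure_def)

text \<open>Apart from the origin, the cone of radius a over E is the unit cone over E dilated by a,
  so its volume carries the factor a^n. The factor n in the surface measure cancels the 1/n in the
  radial mass a^n / n.\<close>

lemma emeasure_truncated_cone:
  fixes E :: "(real^'n) set"
  assumes E: "E \<in> sets sphere_measure"
  shows "emeasure lborel {y. sphere_dir y \<in> E \<and> norm y < a} =
    emeasure sphere_measure E * emeasure (radial_measure CARD('n)) {..<a}"
proof (cases "a > 0")
  case True
  define C where "C = {r *\<^sub>R e | r e. e \<in> E \<and> 0 < r \<and> r < 1}"
  have EE: "E \<in> sets borel" "E \<subseteq> sphere 0 1"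
    using E by (auto simp: sets_sphere_measure sets_restrict_space_iff)
  then have E1: "norm e = 1" if "e \<in> E" for e using that by auto
  have mE: "{y. sphere_dir y \<in> E} \<in> sets borel"
    using measurable_sets_borel[OF measurable_sphere_dir_borel EE(1)] by (simp add: vimage_def)
  \<comment> \<open>The origin is removed because \<open>sphere_dir 0\<close> is an arbitrary unit
    vector that may lie in \<open>E\<close>, whereas \<open>C\<close> contains only points with
    positive radius. The summand 0 gives the map the affine form of the scaling rule for Lebesgue
    measure.\<close>
  have *: "{y. sphere_dir y \<in> E \<and> norm y < b} - {0} = (\<lambda>x. b *\<^sub>R x + 0) ` C" if b: "b > 0" for b
  proof (intro set_eqI iffI)
    fix y assume y: "y \<in> {y. sphere_dir y \<in> E \<and> norm y < b} - {0}"
    then have "sphere_dir y \<in> E \<and> 0 < norm y / b \<and> norm y / b < 1" using b by auto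
    then have "(norm y / b) *\<^sub>R sphere_dir y \<in> C" unfolding C_def by blast
    moreover have "y = b *\<^sub>R ((norm y / b) *\<^sub>R sphere_dir y) + 0" using b by simp
    ultimately show "y \<in> (\<lambda>x. b *\<^sub>R x + 0) ` C" by blast
  next
    fix y assume "y \<in> (\<lambda>x. b *\<^sub>R x + 0) ` C"
    then obtain r e where re: "e \<in> E" "0 < r" "r < 1" "y = (b * r) *\<^sub>R e" by (auto simp: C_def)
    then have "norm y = b * r" "y \<noteq> 0" using E1[of e] b by auto
    moreover have "norm y *\<^sub>R sphere_dir y = norm y *\<^sub>R e"
      using trans[OF sphere_dir_scale re(4)] unfolding \<open>norm y = b * r\<close> .
    then have "sphere_dir y = e"
      using \<open>y \<noteq> 0\<close> unfolding scaleR_cancel_left by simp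
    moreover have "b * r < b" using re b by simp
    ultimately show "y \<in> {y. sphere_dir y \<in> E \<and> norm y < b} - {0}"
      using re(1) by (metis (mono_tags, lifting) DiffI mem_Collect_eq singletonD)
  qed
  have mEb: "{y. sphere_dir y \<in> E \<and> norm y < b} \<in> sets borel" for b
  proof -
    have "{y. sphere_dir y \<in> E} \<inter> ball 0 b \<in> sets borel" using mE by (intro sets.Int) auto
    also have "{y. sphere_dir y \<in> E} \<inter> ball 0 b = {y. sphere_dir y \<in> E \<and> norm y < b}" by auto
    finally show ?thesis .
  qed
  \<comment> \<open>For b = 1 the dilation is the identity, so \<open>C\<close> is a Borel set minus
    a point.\<close>
  have mC: "C \<in> sets borel"
    using *[of 1] mEb[of 1] by (metis (no_types, lifting) add_0_right image_cong image_ident insert_absorb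
       scaleR_one sets.Diff borel_singleton sets.empty_sets zero_less_one)
  have "emeasure lborel {y. sphere_dir y \<in> E \<and> norm y < a} =
      emeasure lborel ({y. sphere_dir y \<in> E \<and> norm y < a} - {0})"
    using mEb[of a] by (subst emeasure_Diff_null_set) auto
  also have "\<dots> = emeasure lebesgue ((\<lambda>x. a *\<^sub>R x + 0) ` C)"
    using mEb[of a] by (subst *[OF True, symmetric]) auto
  also have "\<dots> = ennreal (a ^ CARD('n)) * emeasure lborel C"
    using True mC by (subst emeasure_lebesgue_affine) auto
  also have "\<dots> = emeasure sphere_measure E * emeasure (radial_measure CARD('n)) {..<a}"
  proof -
    have "emeasure sphere_measure E = of_nat CARD('n) * emeasure lborel C"
      unfolding C_def by (rule emeasure_sphere_measure[OF EE])
    moreover have "ennreal (a ^ CARD('n)) = of_nat CARD('n) * ennreal (a ^ CARD('n) / CARD('n))"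
      unfolding ennreal_of_nat_eq_real_of_nat using True by (subst ennreal_mult[symmetric]) auto
    ultimately show ?thesis
      using True
      by (simp add: emeasure_radial_measure mult_ac)
  qed
  finally show ?thesis .
next
  case False
  then have "{y. sphere_dir y \<in> E \<and> norm y < a} = {}"
    by (auto simp: not_less intro: order.trans)
  then show ?thesis using False by (simp only: emeasure_radial_measure[OF zero_less_card_finite]) simp
qed

text \<open>A product of sigma-finite measures is determined by its values on rectangles, and
  truncated cones supply these values for rectangles E x (-\<infinity>, a).\<close>

lemma distr_polar_coordinates:
  "distr lborel (sphere_measure \<Otimes>\<^sub>M radial_measure CARD('n)) (\<lambda>y::real^'n. (sphere_dir y, norm y)) =
    sphere_measure \<Otimes>\<^sub>M radial_measure CARD('n)"
proof -
  let ?\<rho> = "radial_measure CARD('n)"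
  interpret finite_measure "sphere_measure :: (real^'n) measure" by (rule finite_sphere_measure)
  have sets_\<rho>: "sets ?\<rho> = sets borel" by (simp add: radial_measure_def)
  have [measurable]: "(\<lambda>y::real^'n. (sphere_dir y, norm y)) \<in> borel \<rightarrow>\<^sub>M sphere_measure \<Otimes>\<^sub>M ?\<rho>"
    unfolding measurable_cong_sets[OF refl sets_pair_measure_cong[OF refl sets_\<rho>]] by measurable
  show ?thesis
  proof (rule pair_measure_eqI[symmetric])
    show "sigma_finite_measure ?\<rho>" by (rule sigma_finite_radial_measure) simp
    fix E :: "(real^'n) set" and B
    assume E [measurable]: "E \<in> sets sphere_measure" and B: "B \<in> sets ?\<rho>"
    define \<mu> where "\<mu> = distr (density lborel (indicator {y. sphere_dir y \<in> E})) borel (norm :: real^'n \<Rightarrow> real)"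
    have mE [measurable]: "{y. sphere_dir y \<in> E} \<in> sets borel"
      using measurable_sets[OF measurable_sphere_dir E] by (simp add: vimage_def)
    have \<mu>: "emeasure \<mu> A = emeasure lborel {y. sphere_dir y \<in> E \<and> norm y \<in> A}" if [measurable]: "A \<in> sets borel" for A
    proof -
      have "norm -` A \<in> sets (borel :: (real^'n) measure)" 
        by (rule measurable_sets_borel[OF borel_measurable_norm]) auto
      then show ?thesis
      unfolding \<mu>_def
      by (subst emeasure_distr; simp) (subst emeasure_density; auto intro!: arg_cong[where f="emeasure lborel"]
          simp flip: indicator_inter_arith simp: nn_integral_indicator)
    qed
    \<comment> \<open>With \<open>E\<close> fixed, both sides are measures in the radial variable.
      The half-lines \<open>{..<a}\<close> are closed under intersection, generate the Borel sets,
      and those with natural endpoints exhaust the line with finite mass.\<close>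
    have "scale_measure (emeasure sphere_measure E) ?\<rho> = \<mu>"
    proof (rule measure_eqI_generator_eq[where E="range lessThan" and \<Omega>=UNIV and A="\<lambda>i. {..<real i}"])
      show "Int_stable (range (lessThan :: real \<Rightarrow> _))"
        unfolding Int_stable_def
        by (metis (no_types, opaque_lifting) greaterThan_Int_greaterThan image_iff lessThan_Int_lessThan rangeI)
      show "sets (scale_measure (emeasure sphere_measure E) ?\<rho>) = sigma_sets UNIV (range lessThan)"
        using sets_\<rho> by (simp add: borel_Iio)
      show "sets \<mu> = sigma_sets UNIV (range lessThan)"
        by (simp add: \<mu>_def borel_Iio)
      show "(\<Union>i. {..<real i}) = UNIV" using reals_Archimedean2 by auto
      show "emeasure (scale_measure (emeasure sphere_measure E) ?\<rho>) {..<real i} \<noteq> \<infinity>" for i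
        by (simp add: emeasure_radial_measure ennreal_mult_eq_top_iff emeasure_finite[unfolded infinity_ennreal_def])
      fix X :: "real set" assume "X \<in> range lessThan"
      then obtain a where X: "X = {..<a}" by auto
      show "emeasure (scale_measure (emeasure sphere_measure E) ?\<rho>) X = emeasure \<mu> X"
        unfolding X using emeasure_truncated_cone[OF E, of a] by (simp add: \<mu>)
    qed auto
    then have "emeasure sphere_measure E * emeasure ?\<rho> B = emeasure \<mu> B"
      by (metis emeasure_scale_measure)
    also have "\<dots> = emeasure (distr lborel (sphere_measure \<Otimes>\<^sub>M ?\<rho>) (\<lambda>y::real^'n. (sphere_dir y, norm y))) (E \<times> B)"
      using B E sets_\<rho> by (subst emeasure_distr) (auto simp: \<mu> intro!: arg_cong[where f="emeasure lborel"])
    finally show "emeasure sphere_measure E * emeasure ?\<rho> B = \<dots>" .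
  qed (auto intro: sigma_finite_measure_axioms)
qed

lemma nn_integral_polar_coordinates:
  fixes g :: "(real^'n) \<times> real \<Rightarrow> ennreal"
  assumes [measurable]: "g \<in> borel_measurable (sphere_measure \<Otimes>\<^sub>M borel)"
  shows "(\<integral>\<^sup>+y. g (sphere_dir y, norm y) \<partial>lborel) =
    (\<integral>\<^sup>+\<theta>. (\<integral>\<^sup>+r\<in>{0<..}. ennreal (r ^ (CARD('n) - 1)) * g (\<theta>, r) \<partial>lborel) \<partial>sphere_measure)"
proof -
  let ?\<rho> = "radial_measure CARD('n)"
  interpret R: sigma_finite_measure ?\<rho> by (rule sigma_finite_radial_measure) simp
  have sets_\<rho>: "sets ?\<rho> = sets borel" by (simp add: radial_measure_def)
  note cong = measurable_cong_sets[OF sets_pair_measure_cong[OF refl sets_\<rho>]]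
    measurable_cong_sets[OF refl sets_pair_measure_cong[OF refl sets_\<rho>]]
  have m: "g \<in> borel_measurable (sphere_measure \<Otimes>\<^sub>M ?\<rho>)"
    by (subst cong(1)) (auto simp: assms)
  have [measurable]: "(\<lambda>y::real^'n. (sphere_dir y, norm y)) \<in> borel \<rightarrow>\<^sub>M sphere_measure \<Otimes>\<^sub>M ?\<rho>"
    unfolding cong(2) by measurable
  have "(\<integral>\<^sup>+y. g (sphere_dir y, norm y) \<partial>lborel) =
    (\<integral>\<^sup>+z. g z \<partial>distr lborel (sphere_measure \<Otimes>\<^sub>M ?\<rho>) (\<lambda>y::real^'n. (sphere_dir y, norm y)))"
    using m by (subst nn_integral_distr) auto
  also have "\<dots> = (\<integral>\<^sup>+\<theta>. (\<integral>\<^sup>+r. g (\<theta>, r) \<partial>?\<rho>) \<partial>sphere_measure)"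
    unfolding distr_polar_coordinates by (rule R.nn_integral_fst[OF m, symmetric])
  also have "\<dots> = (\<integral>\<^sup>+\<theta>. (\<integral>\<^sup>+r\<in>{0<..}. ennreal (r ^ (CARD('n) - 1)) * g (\<theta>, r) \<partial>lborel) \<partial>sphere_measure)"
    unfolding radial_measure_def
    by (intro nn_integral_cong, subst nn_integral_density) (auto simp: mult_ac)
  finally show ?thesis .
qed

lemma nn_integral_polar_product_borel:
  fixes u :: "real^'n \<Rightarrow> ennreal"
  assumes [measurable]: "u \<in> borel_measurable sphere_measure" "v \<in> borel_measurable borel"
  shows "(\<integral>\<^sup>+y. u (sphere_dir y) * v (norm (y :: real^'n)) \<partial>lborel) =
    (\<integral>\<^sup>+\<theta>. u \<theta> \<partial>sphere_measure) * (\<integral>\<^sup>+r\<in>{0<..}. ennreal (r ^ (CARD('n) - 1)) * v r \<partial>lborel)"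
proof -
  have "(\<integral>\<^sup>+y. u (sphere_dir y) * v (norm (y :: real^'n)) \<partial>lborel) =
      (\<integral>\<^sup>+\<theta>. (\<integral>\<^sup>+r\<in>{0<..}. ennreal (r ^ (CARD('n) - 1)) * (u \<theta> * v r) \<partial>lborel) \<partial>sphere_measure)"
    using nn_integral_polar_coordinates[of "\<lambda>z. u (fst z) * v (snd z)"] by simp
  also have "\<dots> = (\<integral>\<^sup>+\<theta>. u \<theta> * (\<integral>\<^sup>+r\<in>{0<..}. ennreal (r ^ (CARD('n) - 1)) * v r \<partial>lborel) \<partial>sphere_measure)"
    by (intro nn_integral_cong, subst nn_integral_cmult[symmetric]) (auto simp: mult_ac)
  finally show ?thesis by (simp add: nn_integral_multc)
qed

section \<open>Null sets and measurability under norm, direction and reflection\<close>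

text \<open>The map need not preserve measure: it suffices that preimages of null sets are null.
  This is the form that fits \<open>norm\<close> and \<open>sphere_dir\<close>.\<close>

lemma AE_compose_nonsingular:
  assumes f: "f \<in> M \<rightarrow>\<^sub>M N" and null: "null_sets N \<subseteq> null_sets (distr M N f)"
    and P: "AE x in N. P x"
  shows "AE y in M. P (f y)"
proof -
  obtain S where S: "S \<in> null_sets N" "{x \<in> space N. \<not> P x} \<subseteq> S"
    using P unfolding eventually_ae_filter by auto
  then have "AE y in M. f y \<notin> S"
    using null by (intro AE_distrD[OF f] AE_not_in) auto
  then show ?thesis
    using AE_space by eventually_elim (use S(2) measurable_space[OF f] in auto)
qed

text \<open>A function such as h is only Lebesgue measurable, and composing it with a merely Borel
  map could destroy measurability. Null preimages rule this out for h(|y|); in polar coordinates the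
  preimage of N has as its measure a multiple of the integral of r^(n-1) over the positive part of
  N.\<close>

lemma null_sets_norm: "null_sets lborel \<subseteq> null_sets (distr lebesgue lborel (norm :: real^'n \<Rightarrow> real))"
proof
  fix N :: "real set" assume N: "N \<in> null_sets lborel"
  then have [measurable]: "N \<in> sets borel" by auto
  have "emeasure (distr lebesgue lborel (norm :: real^'n \<Rightarrow> real)) N =
      (\<integral>\<^sup>+y. indicator N y \<partial>distr lborel lborel (norm :: real^'n \<Rightarrow> real))"
    by (subst distr_completion) auto
  also have "\<dots> = (\<integral>\<^sup>+y. 1 * indicator N (norm (y :: real^'n)) \<partial>lborel)"
    by (subst nn_integral_distr) auto
  also have "\<dots> = (\<integral>\<^sup>+(\<theta> :: real^'n). 1 \<partial>sphere_measure) * (\<integral>\<^sup>+r\<in>{0<..}. ennreal (r ^ (CARD('n) - 1)) * indicator N r \<partial>lborel)"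
    by (rule nn_integral_polar_product_borel) auto
  also have "(\<integral>\<^sup>+r\<in>{0<..}. ennreal (r ^ (CARD('n) - 1)) * indicator N r \<partial>lborel) = 0"
    using AE_not_in[OF N] by (subst nn_integral_0_iff_AE) (auto elim!: eventually_mono)
  finally show "N \<in> null_sets (distr lebesgue lborel (norm :: real^'n \<Rightarrow> real))" by auto
qed

lemma null_sets_sphere_dir:
  "null_sets sphere_measure \<subseteq> null_sets (distr lebesgue sphere_measure (sphere_dir :: real^'n \<Rightarrow> real^'n))"
proof
  fix N :: "(real^'n) set" assume N: "N \<in> null_sets sphere_measure"
  then have [measurable]: "N \<in> sets sphere_measure" by auto
  have "emeasure (distr lebesgue sphere_measure sphere_dir) N =
      (\<integral>\<^sup>+y. indicator N y \<partial>distr lborel sphere_measure sphere_dir)"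
    by (subst distr_completion) auto
  also have "\<dots> = (\<integral>\<^sup>+y. indicator N (sphere_dir y) * 1 \<partial>lborel)"
    by (subst nn_integral_distr) auto
  also have "\<dots> = (\<integral>\<^sup>+\<theta>. indicator N \<theta> \<partial>sphere_measure) * (\<integral>\<^sup>+r\<in>{0<..}. ennreal (r ^ (CARD('n) - 1)) * 1 \<partial>lborel)"
    by (rule nn_integral_polar_product_borel) auto
  \<comment> \<open>The radial factor is infinite here; the product still vanishes by the convention
    that 0 times \<infinity> is 0 in \<open>ennreal\<close>.\<close>
  also have "(\<integral>\<^sup>+\<theta>. indicator N \<theta> \<partial>sphere_measure) = 0"
    using N by auto
  finally show "N \<in> null_sets (distr lebesgue sphere_measure sphere_dir)" by auto
qed

lemma measurable_norm_lebesgue: "(norm :: real^'n \<Rightarrow> real) \<in> lebesgue \<rightarrow>\<^sub>M lebesgue"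
  by (rule completion.measurable_completion2[OF _ null_sets_norm]) (intro measurable_completion, simp)

lemma AE_lebesgue_norm: "AE r in lebesgue. P r \<Longrightarrow> AE y in lebesgue. P (norm (y :: real^'n))"
  by (rule AE_compose_nonsingular[OF _ null_sets_norm])
    (intro measurable_completion, simp, simp add: AE_completion_iff)

lemma measurable_sphere_dir_lebesgue:
  "(sphere_dir :: real^'n \<Rightarrow> real^'n) \<in> lebesgue \<rightarrow>\<^sub>M sphere_measure"
  by (intro measurable_completion) simp

lemma measurable_sphere_dir_surface:
  "(sphere_dir :: real^'n \<Rightarrow> real^'n) \<in> lebesgue \<rightarrow>\<^sub>M surface_measure"
  unfolding surface_measure_def
  by (rule completion.measurable_completion2[OF measurable_sphere_dir_lebesgue null_sets_sphere_dir])

lemma AE_lebesgue_sphere_dir: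
  "AE \<theta> in sphere_measure. P \<theta> \<Longrightarrow> AE y in lebesgue. P (sphere_dir (y :: real^'n))"
  by (rule AE_compose_nonsingular[OF measurable_sphere_dir_lebesgue null_sets_sphere_dir])

lemma distr_lborel_reflect:
  fixes x :: "'a::euclidean_space"
  shows "distr lborel borel (\<lambda>y. x - y) = lborel"
  using lborel_affine[of "-1" x] by (simp add: density_1)

lemma measurable_reflect_lebesgue:
  fixes x :: "'a::euclidean_space"
  shows "(\<lambda>y. x - y) \<in> lebesgue \<rightarrow>\<^sub>M lebesgue"
proof (rule completion.measurable_completion2)
  show "(\<lambda>y. x - y) \<in> lebesgue \<rightarrow>\<^sub>M lborel" by (intro measurable_completion) simp
  have "distr lebesgue lborel (\<lambda>y. x - y) = lborel"
    using distr_lborel_reflect[of x] by (subst distr_completion) (auto cong: distr_cong)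
  then show "null_sets lborel \<subseteq> null_sets (distr lebesgue lborel (\<lambda>y. x - y))" by simp
qed

lemma AE_lebesgue_reflect:
  fixes x :: "'a::euclidean_space"
  assumes "AE y in lebesgue. P y"
  shows "AE y in lebesgue. P (x - y)"
proof -
  have "AE y in distr lborel borel (\<lambda>y. x - y). P y"
    using assms unfolding distr_lborel_reflect by (simp add: AE_completion_iff)
  then have "AE y in lborel. P (x - y)" by (rule AE_distrD[rotated]) simp
  then show ?thesis by (rule AE_completion)
qed

text \<open>Passes from Borel functions to the completed measures: u and v are replaced by Borel
  representatives, and the exceptional sets pull back to null sets under direction and norm.\<close>

lemma nn_integral_polar_product:
  fixes u :: "real^'n \<Rightarrow> ennreal"
  assumes u: "u \<in> borel_measurable surface_measure" and v: "v \<in> borel_measurable lebesgue"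
  shows "(\<integral>\<^sup>+y. u (sphere_dir y) * v (norm (y :: real^'n)) \<partial>lebesgue) =
    (\<integral>\<^sup>+\<theta>. u \<theta> \<partial>surface_measure) * (\<integral>\<^sup>+r\<in>{0<..}. ennreal (r ^ (CARD('n) - 1)) * v r \<partial>lebesgue)"
proof -
  obtain u' where u'[measurable]: "u' \<in> borel_measurable sphere_measure"
    and uu': "AE \<theta> in sphere_measure. u \<theta> = u' \<theta>"
    using completion_ex_borel_measurable[OF u[unfolded surface_measure_def]] by auto
  obtain v' where v'[measurable]: "v' \<in> borel_measurable lborel"
    and vv': "AE r in lborel. v r = v' r"
    using completion_ex_borel_measurable[OF v] by auto
  have "AE y in lebesgue. v (norm (y :: real^'n)) = v' (norm y)"
    using vv' by (intro AE_lebesgue_norm AE_completion)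
  then have "(\<integral>\<^sup>+y. u (sphere_dir y) * v (norm (y :: real^'n)) \<partial>lebesgue) =
      (\<integral>\<^sup>+y. u' (sphere_dir y) * v' (norm (y :: real^'n)) \<partial>lebesgue)"
    using AE_lebesgue_sphere_dir[OF uu'] by (intro nn_integral_cong_AE) (auto elim: eventually_elim2)
  also have "\<dots> = (\<integral>\<^sup>+y. u' (sphere_dir y) * v' (norm (y :: real^'n)) \<partial>lborel)"
    by (rule nn_integral_completion)
  also have "\<dots> = (\<integral>\<^sup>+\<theta>. u' \<theta> \<partial>sphere_measure) *
      (\<integral>\<^sup>+r\<in>{0<..}. ennreal (r ^ (CARD('n) - 1)) * v' r \<partial>lborel)"
    using v' by (intro nn_integral_polar_product_borel) auto
  also have "(\<integral>\<^sup>+\<theta>. u' \<theta> \<partial>sphere_measure) = (\<integral>\<^sup>+\<theta>. u \<theta> \<partial>sphere_measure)"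
    using uu' by (intro nn_integral_cong_AE) (auto elim: eventually_mono)
  also have "(\<integral>\<^sup>+r\<in>{0<..}. ennreal (r ^ (CARD('n) - 1)) * v' r \<partial>lborel) =
      (\<integral>\<^sup>+r\<in>{0<..}. ennreal (r ^ (CARD('n) - 1)) * v r \<partial>lborel)"
    using vv' by (intro nn_integral_cong_AE) (auto elim: eventually_mono)
  finally show ?thesis by (simp add: surface_measure_def nn_integral_completion)
qed

section \<open>Dyadic decomposition of radial integrals\<close>

text \<open>On [R, 2R] the weight is at most R^(-q) and the integral of v at most C R, so the shell
  contributes at most C R^(1-q). For R = 2^k \<epsilon> these bounds form a geometric series with
  ratio 2^(1-q) < 1.\<close>

lemma nn_integral_dyadic_bound:
  fixes v :: "real \<Rightarrow> ennreal"
  assumes [measurable]: "v \<in> borel_measurable lebesgue"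
    and C: "C \<ge> 0" "\<And>R. R > 0 \<Longrightarrow> (\<integral>\<^sup>+r\<in>{R..2*R}. v r \<partial>lebesgue) \<le> ennreal (C * R)"
    and "\<epsilon> > 0" "q > 1"
  shows "(\<integral>\<^sup>+r\<in>{\<epsilon><..}. v r * ennreal (r powr (- q)) \<partial>lebesgue) < \<infinity>"
proof -
  define R where "R k = 2 ^ k * \<epsilon>" for k :: nat
  have R: "R k > 0" for k using \<open>\<epsilon> > 0\<close> by (simp add: R_def)
  have cover: "\<exists>k. r \<in> {R k..2 * R k}" if "r > \<epsilon>" for r
  proof -
    obtain m where m: "r / \<epsilon> < 2 ^ m" using real_arch_pow[of 2 "r / \<epsilon>"] by auto
    \<comment> \<open>Minimality of \<open>k\<close> gives \<open>R k \<le> r\<close>, so r lies in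
      the k-th shell; for \<open>k = 0\<close> this is the assumption r > \<epsilon>. Overlapping
      endpoints of the shells do no harm in an upper bound.\<close>
    define k where "k = (LEAST m. r < R (Suc m))"
    have "r < R m" using m \<open>\<epsilon> > 0\<close> by (simp add: R_def field_simps)
    also have "R m \<le> R (Suc m)" using \<open>\<epsilon> > 0\<close> by (simp add: R_def)
    finally have "r < R (Suc k)" unfolding k_def by (rule LeastI)
    moreover have "R k \<le> r"
    proof (cases k)
      case 0
      then show ?thesis using that by (simp add: R_def)
    next
      case (Suc j)
      then show ?thesis using not_less_Least[of j "\<lambda>m. r < R (Suc m)"] unfolding k_def by simp
    qed
    ultimately show ?thesis by (auto simp: R_def intro!: exI[of _ k])
  qed
  have "(\<integral>\<^sup>+r\<in>{\<epsilon><..}. v r * ennreal (r powr (- q)) \<partial>lebesgue) \<le>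
      (\<integral>\<^sup>+r. (\<Sum>k. ennreal (R k powr (- q)) * (v r * indicator {R k..2 * R k} r)) \<partial>lebesgue)"
  proof (intro nn_integral_mono)
    fix r
    show "v r * ennreal (r powr (- q)) * indicator {\<epsilon><..} r \<le>
        (\<Sum>k. ennreal (R k powr (- q)) * (v r * indicator {R k..2 * R k} r))"
    proof (cases "r > \<epsilon>")
      case True
      then obtain k where k: "r \<in> {R k..2 * R k}" using cover by blast
      then have "r powr (- q) \<le> R k powr (- q)"
        using R[of k] \<open>q > 1\<close> by (intro powr_mono2') auto
      then have "v r * ennreal (r powr (- q)) * indicator {\<epsilon><..} r \<le>
          ennreal (R k powr (- q)) * (v r * indicator {R k..2 * R k} r)"
        using True k by (simp add: mult.commute mult_left_mono ennreal_leI)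
      also have "\<dots> = (\<Sum>k\<in>{k}. ennreal (R k powr (- q)) * (v r * indicator {R k..2 * R k} r))" by simp
      also have "\<dots> \<le> (\<Sum>k. ennreal (R k powr (- q)) * (v r * indicator {R k..2 * R k} r))"
        by (intro sum_le_suminf) auto
      finally show ?thesis .
    qed simp
  qed
  also have "\<dots> = (\<Sum>k. ennreal (R k powr (- q)) * (\<integral>\<^sup>+r\<in>{R k..2 * R k}. v r \<partial>lebesgue))"
  proof -
    have m: "(\<lambda>r. v r * indicator {R k..2 * R k} r) \<in> borel_measurable lebesgue" for k
      using assms(1) by (intro borel_measurable_times_ennreal borel_measurable_indicator) auto
    then show ?thesis
      by (subst nn_integral_suminf) (auto intro!: borel_measurable_times_ennreal simp: nn_integral_cmult)
  qed
  also have "\<dots> \<le> (\<Sum>k. ennreal (R k powr (- q)) * ennreal (C * R k))"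
    using C(2) R by (intro suminf_le mult_left_mono) auto
  also have "\<dots> = (\<Sum>k. ennreal (C * \<epsilon> powr (1 - q) * (2 powr (1 - q)) ^ k))"
  proof (intro suminf_cong)
    fix k
    have "R k powr (- q) * (C * R k) = C * R k powr (1 - q)"
      using R[of k] by (simp add: powr_diff powr_minus field_simps)
    also have "R k powr (1 - q) = \<epsilon> powr (1 - q) * (2 powr (1 - q)) ^ k"
    proof -
      have "(2 ^ k) powr (1 - q) = (2 powr real k) powr (1 - q)"
        by (subst powr_realpow) auto
      also have "\<dots> = (2 powr (1 - q)) powr real k"
        unfolding powr_powr by (subst mult.commute) (rule refl)
      also have "\<dots> = (2 powr (1 - q)) ^ k"
        by (rule powr_realpow) simp
      finally show ?thesis
        using \<open>\<epsilon> > 0\<close> unfolding R_def by (subst powr_mult) (auto simp only: mult.commute)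
    qed
    finally show "ennreal (R k powr (- q)) * ennreal (C * R k) =
        ennreal (C * \<epsilon> powr (1 - q) * (2 powr (1 - q)) ^ k)"
      using R[of k] C by (simp add: mult_ac flip: ennreal_mult)
  qed
  also have "\<dots> < \<infinity>"
  proof -
    have "2 powr (1 - q) < (1::real)" using \<open>q > 1\<close> by (simp add: powr_less_one)
    then have "summable (\<lambda>k. C * \<epsilon> powr (1 - q) * (2 powr (1 - q)) ^ k)"
      by (intro summable_mult summable_geometric) simp
    then show ?thesis using C by (subst suminf_ennreal2) auto
  qed
  finally show ?thesis .
qed

subsection \<open>Layer-cake representation\<close>

lemma sigma_finite_lebesgue: "sigma_finite_measure (lebesgue :: 'a::euclidean_space measure)"
proof -
  obtain A :: "'a set set" where "countable A" "A \<subseteq> sets lborel" "\<Union>A = space lborel"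
    "\<forall>a\<in>A. emeasure lborel a \<noteq> \<infinity>"
    using lborel.sigma_finite_countable by blast
  then show ?thesis
    unfolding sigma_finite_measure_def by (intro exI[of _ A]) auto
qed

text \<open>The integral \<open>w = n \<integral> t^(-n-1) dt\<close> over \<open>t^n w \<ge> 1\<close> produces the factor \<open>n dt / t^(n+1)\<close> of the
  representation.\<close>

definition tail_kernel :: "nat \<Rightarrow> real \<Rightarrow> real \<Rightarrow> real" where
  "tail_kernel n w t = (if 0 < t \<and> 1 \<le> t ^ n * w then inverse (t ^ Suc n) else 0)"

lemma measurable_tail_kernel [measurable]:
  assumes [measurable]: "w \<in> borel_measurable M" "t \<in> borel_measurable M"
  shows "(\<lambda>x. tail_kernel n (w x) (t x)) \<in> borel_measurable M"
  unfolding tail_kernel_def by measurable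

lemma tail_kernel_nonneg [simp]: "0 \<le> tail_kernel n w t"
  by (simp add: tail_kernel_def)

lemma nn_integral_tail_kernel:
  assumes "n > 0" "w \<ge> 0"
  shows "(\<integral>\<^sup>+t. ennreal (tail_kernel n w t) \<partial>lborel) = ennreal (w / n)"
proof (cases "w = 0")
  case True
  then show ?thesis by (simp add: tail_kernel_def)
next
  case False
  then have "w > 0" using assms by simp
  \<comment> \<open>The threshold at which t^n w reaches 1; the kernel is t^(-n-1) from there on and
    0 before.\<close>
  define a where "a = root n (inverse w)"
  have a: "a > 0" "a ^ n = inverse w"
    using \<open>w > 0\<close> assms by (auto simp: a_def)
  have iff: "0 < t \<and> 1 \<le> t ^ n * w \<longleftrightarrow> a \<le> t" for t
  proof (cases "t > 0")
    case True
    have "1 \<le> t ^ n * w \<longleftrightarrow> a ^ n \<le> t ^ n"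
      using \<open>w > 0\<close> by (simp add: a field_simps)
    also have "\<dots> \<longleftrightarrow> a \<le> t" using True a(1) assms by (simp add: power_mono_iff)
    finally show ?thesis using True by simp
  qed (use a in auto)
  have "(\<integral>\<^sup>+t. ennreal (tail_kernel n w t) \<partial>lborel) =
      (\<integral>\<^sup>+t. ennreal (inverse (t ^ Suc n)) * indicator {a..} t \<partial>lborel)"
    by (intro nn_integral_cong) (simp add: tail_kernel_def iff indicator_def)
  also have "\<dots> = 0 - (- inverse (n * a ^ n))"
  \<comment> \<open>The antiderivative -1 / (n t^n) vanishes at infinity, so the integral is 1 / (n
    a^n) = w / n.\<close>
  proof (rule nn_integral_FTC_atLeast)
    fix t assume "a \<le> t"
    then have t: "t > 0" using a by simp
    have "((\<lambda>t. real n * t ^ n) has_real_derivative real n * (real n * t ^ (n - 1))) (at t)"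
      using DERIV_cmult[OF DERIV_pow[of n t], of "real n"] by simp
    then have "((\<lambda>t. - inverse (real n * t ^ n)) has_real_derivative
        - (- (inverse (real n * t ^ n) * (real n * (real n * t ^ (n - 1))) * inverse (real n * t ^ n)))) (at t)"
      using t assms by (intro DERIV_minus DERIV_inverse') auto
    \<comment> \<open>Here c stands for n and u for t^(n-1). Writing t^n as u t turns the
      simplification of the derivative into a plain cancellation.\<close>
    moreover have "inverse (c * (u * t)) * (c * (c * u)) * inverse (c * (u * t)) = inverse (u * t * t)"
      if "c > 0" "u > 0" for c u :: real
      using that t by (simp add: field_simps)
    from this[of "real n" "t ^ (n - 1)"]
    have "inverse (real n * t ^ n) * (real n * (real n * t ^ (n - 1))) * inverse (real n * t ^ n) =
        inverse (t ^ Suc n)"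
      using t assms by (cases n) (simp_all add: mult_ac)
    ultimately show "((\<lambda>t. - inverse (n * t ^ n)) has_real_derivative inverse (t ^ Suc n)) (at t)"
      by (simp only: minus_minus)
    show "0 \<le> inverse (t ^ Suc n)" using t by simp
  next
    have "filterlim (\<lambda>t. real n * t ^ n) at_top at_top"
      using assms by (intro filterlim_tendsto_pos_mult_at_top[OF tendsto_const] filterlim_pow_at_top filterlim_ident) auto
    then have "((\<lambda>t::real. - inverse (real n * t ^ n)) \<longlongrightarrow> - 0) at_top"
      by (intro tendsto_minus tendsto_inverse_0_at_top)
    then show "((\<lambda>t::real. - inverse (real n * t ^ n)) \<longlongrightarrow> 0) at_top" by simp
  qed simp
  finally show ?thesis
    using a by (simp add: field_simps)
qed

lemma
  assumes "n > 0" "w \<ge> 0"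
  shows integrable_tail_kernel: "integrable lborel (tail_kernel n w)"
    and integral_tail_kernel: "(\<integral>t. tail_kernel n w t \<partial>lborel) = w / n"
proof -
  have *: "has_bochner_integral lborel (tail_kernel n w) (w / n)"
    using assms by (intro has_bochner_integral_nn_integral) (auto simp: nn_integral_tail_kernel)
  show "integrable lborel (tail_kernel n w)" "(\<integral>t. tail_kernel n w t \<partial>lborel) = w / n"
    using * by (auto simp: has_bochner_integral_iff)
qed

text \<open>The abstract form of the representation: w plays the role of |\<Omega>(y)| / |y|^n and g
  the role of f(x-y) h(|y|) sgn \<Omega>(y). All of it rests on Fubini for the product of
  \<open>tail_kernel\<close> and g.\<close>

lemma
  fixes w :: "'a \<Rightarrow> real" and g :: "'a \<Rightarrow> complex"
  assumes M: "sigma_finite_measure M"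
    and w [measurable]: "w \<in> borel_measurable M" and w0: "\<And>y. w y \<ge> 0"
    and g [measurable]: "g \<in> borel_measurable M"
    and int: "integrable M (\<lambda>y. of_real (w y) * g y)" and n: "n > 0"
  shows integrable_superlevel:
      "\<And>t. t > 0 \<Longrightarrow> set_integrable M {y \<in> space M. 1 \<le> t ^ n * w y} g"
    and integrable_layers:
      "set_integrable lebesgue {0<..}
        (\<lambda>t. 1 / of_real (t ^ n) * (LINT y:{y \<in> space M. 1 \<le> t ^ n * w y}|M. g y) / of_real t)"
    and integral_layers:
      "(\<integral>y. of_real (w y) * g y \<partial>M) = of_nat n * (LINT t:{0<..}|lebesgue.
        1 / of_real (t ^ n) * (LINT y:{y \<in> space M. 1 \<le> t ^ n * w y}|M. g y) / of_real t)"
proof -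
  interpret M: sigma_finite_measure M by fact
  interpret P: pair_sigma_finite lborel M ..
  interpret Q: pair_sigma_finite M lborel ..
  show "set_integrable M {y \<in> space M. 1 \<le> t ^ n * w y} g" if t: "t > 0" for t
    unfolding set_integrable_def
  proof (rule Bochner_Integration.integrable_bound)
    show "integrable M (\<lambda>y. of_real (t ^ n) * (of_real (w y) * g y))"
      using int by (rule integrable_mult_right)
    show "AE y in M. norm (indicat_real {y \<in> space M. 1 \<le> t ^ n * w y} y *\<^sub>R g y)
        \<le> norm (of_real (t ^ n) * (of_real (w y) * g y))"
    proof (intro AE_I2)
      fix y
      have "1 * norm (g y) \<le> (t ^ n * w y) * norm (g y)" if "1 \<le> t ^ n * w y"
        using that by (intro mult_right_mono) auto
      then show "norm (indicat_real {y \<in> space M. 1 \<le> t ^ n * w y} y *\<^sub>R g y)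
        \<le> norm (of_real (t ^ n) * (of_real (w y) * g y))"
        using t w0[of y] by (auto simp: norm_mult norm_power indicator_def mult_ac)
    qed
  qed measurable
  \<comment> \<open>The t-integral of |K| equals |w g| / n, so integrability of w g is exactly what
    makes \<open>K\<close> integrable on the product space.\<close>
  define K where "K t y = of_real (tail_kernel n (w y) t) * g y" for t y
  have [measurable]: "case_prod K \<in> borel_measurable (lborel \<Otimes>\<^sub>M M)"
    unfolding K_def by measurable
  have norm_K: "(\<integral>t. norm (K t y) \<partial>lborel) = norm (of_real (w y) * g y) / n" for y
    using w0[of y] integral_tail_kernel[OF n w0, of y] by (simp add: K_def norm_mult)
  have "integrable (M \<Otimes>\<^sub>M lborel) (\<lambda>(y, t). K t y)"
  proof (rule Q.Fubini_integrable)
    show "(\<lambda>(y, t). K t y) \<in> borel_measurable (M \<Otimes>\<^sub>M lborel)"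
      unfolding K_def by measurable
    show "integrable M (\<lambda>y. \<integral>t. norm ((\<lambda>(y, t). K t y) (y, t)) \<partial>lborel)"
      using int by (simp add: norm_K)
    show "AE y in M. integrable lborel (\<lambda>t. (\<lambda>(y, t). K t y) (y, t))"
      unfolding K_def using integrable_tail_kernel[OF n w0] by (simp add: integrable_of_real)
  qed
  then have intK: "integrable (lborel \<Otimes>\<^sub>M M) (case_prod K)"
    using P.integrable_product_swap_iff[of "case_prod K"] by (simp add: case_prod_beta)
  define L where "L t = (\<integral>y. K t y \<partial>M)" for t
  have [measurable]: "L \<in> borel_measurable lborel" unfolding L_def by measurable
  \<comment> \<open>The factors 1/t^n and 1/t combine to the t^(-n-1) of the kernel. For t \<le> 0
    both sides are 0, so the identity holds on the whole line.\<close>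
  have L: "indicat_real {0<..} t *\<^sub>R
     (1 / of_real (t ^ n) * (LINT y:{y \<in> space M. 1 \<le> t ^ n * w y}|M. g y) / of_real t) = L t" for t
  proof (cases "t > 0")
    case True
    have "L t = (\<integral>y. of_real (inverse (t ^ Suc n)) * (indicat_real {y \<in> space M. 1 \<le> t ^ n * w y} y *\<^sub>R g y) \<partial>M)"
      unfolding L_def K_def using True
      by (intro Bochner_Integration.integral_cong) (auto simp: tail_kernel_def indicator_def)
    also have "\<dots> = of_real (inverse (t ^ Suc n)) * (LINT y:{y \<in> space M. 1 \<le> t ^ n * w y}|M. g y)"
      unfolding set_lebesgue_integral_def by (rule integral_mult_right_zero)
    finally show ?thesis using True by (simp add: field_simps)
  next
    case False
    then show ?thesis by (simp add: L_def K_def tail_kernel_def)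
  qed
  have "integrable lborel L"
    using P.integrable_fst'[OF intK] by (simp add: L_def[abs_def])
  then show "set_integrable lebesgue {0<..}
        (\<lambda>t. 1 / of_real (t ^ n) * (LINT y:{y \<in> space M. 1 \<le> t ^ n * w y}|M. g y) / of_real t)"
    unfolding set_integrable_def L by (simp add: integrable_completion)
  have "(\<integral>y. of_real (w y) * g y \<partial>M) = (\<integral>y. of_nat n * (\<integral>t. K t y \<partial>lborel) \<partial>M)"
    using n integral_tail_kernel[OF n w0] by (simp add: K_def integral_of_real)
  also have "\<dots> = of_nat n * (\<integral>y. (\<integral>t. K t y \<partial>lborel) \<partial>M)" by simp
  also have "(\<integral>y. (\<integral>t. K t y \<partial>lborel) \<partial>M) = (\<integral>t. L t \<partial>lborel)"
    unfolding L_def by (rule P.Fubini_integral[OF intK])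
  also have "\<dots> = (LINT t:{0<..}|lebesgue.
        1 / of_real (t ^ n) * (LINT y:{y \<in> space M. 1 \<le> t ^ n * w y}|M. g y) / of_real t)"
    unfolding set_lebesgue_integral_def[of lebesgue] L by (rule integral_completion[symmetric]) measurable
  finally show "(\<integral>y. of_real (w y) * g y \<partial>M) = of_nat n * \<dots>" .
qed

subsection \<open>Absolute convergence\<close>

text \<open>Two points of the line inside the ball are less than 2N apart, and for a unit direction
  distance equals parameter difference. Centering an interval at one such parameter s costs a factor
  2 against the true chord length, which is harmless.\<close>

lemma nn_integral_chord_le:
  fixes z \<theta> :: "'a::euclidean_space"
  assumes "norm \<theta> = 1" "N > 0"
  shows "(\<integral>\<^sup>+r. indicator (ball 0 N) (z + r *\<^sub>R \<theta>) \<partial>lborel) \<le> ennreal (4 * N)"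
proof (cases "\<exists>r. z + r *\<^sub>R \<theta> \<in> ball 0 N")
  case True
  then obtain s where s: "norm (z + s *\<^sub>R \<theta>) < N" by auto
  have "r \<in> {s - 2 * N..s + 2 * N}" if "norm (z + r *\<^sub>R \<theta>) < N" for r
  proof -
    have "\<bar>r - s\<bar> = norm ((z + r *\<^sub>R \<theta>) - (z + s *\<^sub>R \<theta>))"
      using assms(1) by (simp flip: scaleR_diff_left)
    also have "\<dots> \<le> norm (z + r *\<^sub>R \<theta>) + norm (z + s *\<^sub>R \<theta>)" by (rule norm_triangle_ineq4)
    finally show ?thesis using s that by auto
  qed
  then have "(\<integral>\<^sup>+r. indicator (ball 0 N) (z + r *\<^sub>R \<theta>) \<partial>lborel) \<le>
      (\<integral>\<^sup>+r. indicator {s - 2 * N..s + 2 * N} r \<partial>lborel)"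
    by (intro nn_integral_mono) (auto simp: indicator_def)
  also have "\<dots> = ennreal (4 * N)" using assms by simp
  finally show ?thesis .
next
  case False
  then show ?thesis by (simp add: indicator_def)
qed

text \<open>The potential is integrable over every ball \<open>B\<close>: after exchanging the integrals, what remains is
  the length of the chord that \<open>B\<close> cuts out of a line.\<close>

lemma AE_finite_directional_potential:
  fixes u :: "real^'n \<Rightarrow> ennreal" and F :: "real^'n \<Rightarrow> ennreal"
  assumes u: "u \<in> borel_measurable surface_measure" "(\<integral>\<^sup>+\<theta>. u \<theta> \<partial>surface_measure) < \<infinity>"
    and F: "F \<in> borel_measurable lebesgue" "(\<integral>\<^sup>+y. F y \<partial>lebesgue) < \<infinity>"
  shows "AE x in lebesgue.
    (\<integral>\<^sup>+y. u (sphere_dir y) * ennreal (inverse (norm y ^ (CARD('n) - 1))) * F (x - y) \<partial>lebesgue) < \<infinity>"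
proof -
  let ?n = "CARD('n)"
  obtain u' where u'[measurable]: "u' \<in> borel_measurable sphere_measure"
    and uu': "AE \<theta> in sphere_measure. u \<theta> = u' \<theta>"
    using completion_ex_borel_measurable[OF u(1)[unfolded surface_measure_def]] by auto
  obtain F' where "F' \<in> borel_measurable lborel"
    and FF': "AE y in lborel. F y = F' y"
    using completion_ex_borel_measurable[OF F(1)] by auto
  then have F'[measurable]: "F' \<in> borel_measurable borel" by simp
  have U: "(\<integral>\<^sup>+\<theta>. u' \<theta> \<partial>sphere_measure) < \<infinity>"
  proof -
    have "(\<integral>\<^sup>+\<theta>. u' \<theta> \<partial>sphere_measure) = (\<integral>\<^sup>+\<theta>. u \<theta> \<partial>sphere_measure)"
      using uu' by (intro nn_integral_cong_AE) (auto elim: eventually_mono)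
    then show ?thesis using u(2) by (simp add: surface_measure_def nn_integral_completion)
  qed
  have IF: "(\<integral>\<^sup>+y. F' y \<partial>lborel) < \<infinity>"
  proof -
    have "(\<integral>\<^sup>+y. F' y \<partial>lborel) = (\<integral>\<^sup>+y. F y \<partial>lborel)"
      using FF' by (intro nn_integral_cong_AE) (auto elim: eventually_mono)
    then show ?thesis using F(2) by (simp add: nn_integral_completion)
  qed
  define k where "k y = u' (sphere_dir y) * ennreal (inverse (norm y ^ (?n - 1)))" for y :: "real^'n"
  have [measurable]: "k \<in> borel_measurable borel" unfolding k_def by measurable
  define G where "G x = (\<integral>\<^sup>+y. k y * F' (x - y) \<partial>lborel)" for x
  have [measurable]: "G \<in> borel_measurable borel" unfolding G_def by measurable
  \<comment> \<open>Passing to Borel representatives is legitimate for every single x, since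
    reflection at x preserves null sets.\<close>
  have G: "(\<integral>\<^sup>+y. u (sphere_dir y) * ennreal (inverse (norm y ^ (?n - 1))) * F (x - y) \<partial>lebesgue) = G x" for x
  proof -
    have "AE y in lebesgue. F (x - y) = F' (x - y)"
      using FF' by (intro AE_lebesgue_reflect AE_completion)
    then have "(\<integral>\<^sup>+y. u (sphere_dir y) * ennreal (inverse (norm y ^ (?n - 1))) * F (x - y) \<partial>lebesgue) =
        (\<integral>\<^sup>+y. k y * F' (x - y) \<partial>lebesgue)"
      using AE_lebesgue_sphere_dir[OF uu'] unfolding k_def
      by (intro nn_integral_cong_AE) (auto elim: eventually_elim2)
    then show ?thesis unfolding G_def nn_integral_completion .
  qed
  \<comment> \<open>The Jacobian r^(n-1) cancels the kernel |y|^(1-n), leaving chord lengths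
    weighted by u'. The bound is uniform in the translation z.\<close>
  have chord: "(\<integral>\<^sup>+y. k y * indicator (ball 0 N) (z + y) \<partial>lborel) \<le>
      (\<integral>\<^sup>+\<theta>. u' \<theta> \<partial>sphere_measure) * ennreal (4 * N)" if "N > 0" for N and z :: "real^'n"
  proof -
    have [measurable]: "ball (0 :: real^'n) N \<in> sets borel" by simp
    have "(\<integral>\<^sup>+y. k y * indicator (ball 0 N) (z + y) \<partial>lborel) =
        (\<integral>\<^sup>+\<theta>. (\<integral>\<^sup>+r\<in>{0<..}. ennreal (r ^ (?n - 1)) *
          (u' \<theta> * ennreal (inverse (r ^ (?n - 1))) * indicator (ball 0 N) (z + r *\<^sub>R id \<theta>)) \<partial>lborel) \<partial>sphere_measure)"
    proof -
      \<comment> \<open>\<open>sphere_measure\<close> carries the trace sigma-algebra on the sphere.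
        Writing \<open>id \<theta>\<close> makes the inclusion into the ambient space visible to the
        measurability prover.\<close>
      have [measurable]: "id \<in> (sphere_measure :: (real^'n) measure) \<rightarrow>\<^sub>M borel"
        unfolding measurable_cong_sets[OF sets_sphere_measure refl]
        by (intro measurable_restrict_space1) auto
      have "(\<lambda>p. u' (fst p) * ennreal (inverse (snd p ^ (?n - 1))) *
          indicator (ball 0 N) (z + snd p *\<^sub>R id (fst p))) \<in> borel_measurable (sphere_measure \<Otimes>\<^sub>M borel)"
        by measurable
      from nn_integral_polar_coordinates[OF this] show ?thesis
        by (simp add: k_def)
    qed
    also have "\<dots> \<le> (\<integral>\<^sup>+\<theta>. u' \<theta> * ennreal (4 * N) \<partial>sphere_measure)"
    proof (rule nn_integral_mono)
      fix \<theta> :: "real^'n" assume "\<theta> \<in> space sphere_measure"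
      then have \<theta>: "norm \<theta> = 1" by (simp add: space_sphere_measure)
      have "(\<integral>\<^sup>+r\<in>{0<..}. ennreal (r ^ (?n - 1)) *
          (u' \<theta> * ennreal (inverse (r ^ (?n - 1))) * indicator (ball 0 N) (z + r *\<^sub>R id \<theta>)) \<partial>lborel) \<le>
        (\<integral>\<^sup>+r. u' \<theta> * indicator (ball 0 N) (z + r *\<^sub>R \<theta>) \<partial>lborel)"
      proof (rule nn_integral_mono)
        fix r :: real
        have "ennreal (r ^ (?n - 1)) * ennreal (inverse (r ^ (?n - 1))) = 1" if "r > 0"
          using that by (subst ennreal_mult[symmetric]) auto
        then have "ennreal (r ^ (?n - 1)) * (a * ennreal (inverse (r ^ (?n - 1))) * b) = a * b"
          if "r > 0" for a b
          using that by (metis (no_types, lifting) mult.assoc mult.commute mult_1)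
        then show "ennreal (r ^ (?n - 1)) *
          (u' \<theta> * ennreal (inverse (r ^ (?n - 1))) * indicator (ball 0 N) (z + r *\<^sub>R id \<theta>)) * indicator {0<..} r
          \<le> u' \<theta> * indicator (ball 0 N) (z + r *\<^sub>R \<theta>)"
          by (cases "r > 0") auto
      qed
      also have "\<dots> = u' \<theta> * (\<integral>\<^sup>+r. indicator (ball 0 N) (z + r *\<^sub>R \<theta>) \<partial>lborel)"
        by (rule nn_integral_cmult) measurable
      also have "\<dots> \<le> u' \<theta> * ennreal (4 * N)"
        using nn_integral_chord_le[OF \<theta> that] by (intro mult_left_mono) auto
      finally show "(\<integral>\<^sup>+r\<in>{0<..}. ennreal (r ^ (?n - 1)) *
          (u' \<theta> * ennreal (inverse (r ^ (?n - 1))) * indicator (ball 0 N) (z + r *\<^sub>R id \<theta>)) \<partial>lborel)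
        \<le> u' \<theta> * ennreal (4 * N)" .
    qed
    finally show ?thesis by (simp add: nn_integral_multc)
  qed
  have "AE x in lborel. x \<in> ball 0 N \<longrightarrow> G x < \<infinity>" if "N > 0" for N
  proof -
    let ?B = "indicator (ball 0 N) :: real^'n \<Rightarrow> ennreal"
    have [measurable]: "ball (0 :: real^'n) N \<in> sets borel" by simp
    have "(\<lambda>p. fst p - snd p) \<in> lborel \<Otimes>\<^sub>M lborel \<rightarrow>\<^sub>M (borel :: (real^'n) measure)" by measurable
    then have [measurable]: "(\<lambda>p. F' (fst p - snd p)) \<in> borel_measurable (lborel \<Otimes>\<^sub>M lborel)"
      by (rule measurable_compose) (rule F')
    have "(\<integral>\<^sup>+x. ?B x * G x \<partial>lborel) = (\<integral>\<^sup>+x. (\<integral>\<^sup>+y. k y * (?B x * F' (x - y)) \<partial>lborel) \<partial>lborel)"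
      unfolding G_def by (simp add: mult.left_commute flip: nn_integral_cmult)
    also have "\<dots> = (\<integral>\<^sup>+y. (\<integral>\<^sup>+x. k y * (?B x * F' (x - y)) \<partial>lborel) \<partial>lborel)"
      by (rule lborel_pair.Fubini'[symmetric]) measurable
    \<comment> \<open>Substitute x = y + z; afterwards F' no longer depends on y, and a second
      exchange isolates the chord integral.\<close>
    also have "\<dots> = (\<integral>\<^sup>+y. (\<integral>\<^sup>+z. k y * (?B (z + y) * F' z) \<partial>lborel) \<partial>lborel)"
    proof (rule nn_integral_cong)
      fix y :: "real^'n"
      have "(\<integral>\<^sup>+x. k y * (?B x * F' (x - y)) \<partial>lborel) =
          (\<integral>\<^sup>+x. k y * (?B x * F' (x - y)) \<partial>distr lborel borel ((+) y))"
        by (simp add: lborel_distr_plus)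
      also have "\<dots> = (\<integral>\<^sup>+z. k y * (?B (y + z) * F' (y + z - y)) \<partial>lborel)"
        by (rule nn_integral_distr) measurable
      finally show "(\<integral>\<^sup>+x. k y * (?B x * F' (x - y)) \<partial>lborel) = (\<integral>\<^sup>+z. k y * (?B (z + y) * F' z) \<partial>lborel)"
        by (simp add: add.commute)
    qed
    also have "\<dots> = (\<integral>\<^sup>+z. (\<integral>\<^sup>+y. F' z * (k y * ?B (z + y)) \<partial>lborel) \<partial>lborel)"
      by (subst lborel_pair.Fubini') (auto simp: mult_ac)
    also have "\<dots> = (\<integral>\<^sup>+z. F' z * (\<integral>\<^sup>+y. k y * ?B (z + y) \<partial>lborel) \<partial>lborel)"
      by (simp add: nn_integral_cmult)
    also have "\<dots> \<le> (\<integral>\<^sup>+z. F' z * ((\<integral>\<^sup>+\<theta>. u' \<theta> \<partial>sphere_measure) * ennreal (4 * N)) \<partial>lborel)"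
      using chord[OF that] by (intro nn_integral_mono mult_left_mono) auto
    also have "\<dots> = (\<integral>\<^sup>+z. F' z \<partial>lborel) * ((\<integral>\<^sup>+\<theta>. u' \<theta> \<partial>sphere_measure) * ennreal (4 * N))"
      by (rule nn_integral_multc) measurable
    also have "\<dots> < \<infinity>"
      using IF U by (auto simp: ennreal_mult_less_top)
    finally have "(\<integral>\<^sup>+x. ?B x * G x \<partial>lborel) \<noteq> \<infinity>" by simp
    then have "AE x in lborel. ?B x * G x \<noteq> \<infinity>"
      by (intro nn_integral_PInf_AE) auto
    then show ?thesis by eventually_elim (auto simp: less_top)
  qed
  then have "AE x in lborel. \<forall>m::nat. x \<in> ball 0 (real (Suc m)) \<longrightarrow> G x < \<infinity>"
    unfolding AE_all_countable by simp
  then have "AE x in lborel. G x < \<infinity>"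
  proof eventually_elim
    fix x assume "\<forall>m::nat. x \<in> ball 0 (real (Suc m)) \<longrightarrow> G x < \<infinity>"
    moreover obtain m where "norm x < real m" using reals_Archimedean2 by blast
    then have "x \<in> ball 0 (real (Suc m))" by simp
    ultimately show "G x < \<infinity>" by blast
  qed
  then show ?thesis unfolding G by (rule AE_completion)
qed

text \<open>The Jacobian r^(n-1) against r^(-n) leaves 1/r, so the integral splits into the mass of
  u on the sphere and a one-dimensional integral.\<close>

lemma nn_integral_radial_kernel_finite:
  fixes u :: "real^'n \<Rightarrow> ennreal"
  assumes u: "u \<in> borel_measurable surface_measure" "(\<integral>\<^sup>+\<theta>. u \<theta> \<partial>surface_measure) < \<infinity>"
    and v [measurable]: "v \<in> borel_measurable lebesgue"
    and fin: "(\<integral>\<^sup>+r\<in>{\<epsilon><..}. v r * ennreal (inverse r) \<partial>lebesgue) < \<infinity>" and "\<epsilon> > 0"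
  shows "(\<integral>\<^sup>+y\<in>{y. \<epsilon> < norm y}. u (sphere_dir y) * ennreal (inverse (norm y ^ CARD('n))) * v (norm y) \<partial>lebesgue) < \<infinity>"
proof -
  define v' where "v' r = ennreal (inverse (r ^ CARD('n))) * v r * indicator {\<epsilon><..} r" for r
  have m: "v' \<in> borel_measurable lebesgue"
  proof -
    have "(\<lambda>r. ennreal (inverse (r ^ CARD('n))) * indicator {\<epsilon><..} r) \<in> borel_measurable lebesgue"
      by (intro measurable_completion) measurable
    from borel_measurable_times_ennreal[OF this v] show ?thesis
      unfolding v'_def by (simp add: mult_ac)
  qed
  have "(\<integral>\<^sup>+y\<in>{y. \<epsilon> < norm y}. u (sphere_dir y) * ennreal (inverse (norm y ^ CARD('n))) * v (norm y) \<partial>lebesgue) =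
      (\<integral>\<^sup>+y. u (sphere_dir y) * v' (norm (y :: real^'n)) \<partial>lebesgue)"
    by (intro nn_integral_cong) (simp add: v'_def indicator_def mult_ac)
  also have "\<dots> = (\<integral>\<^sup>+\<theta>. u \<theta> \<partial>surface_measure) *
      (\<integral>\<^sup>+r\<in>{0<..}. ennreal (r ^ (CARD('n) - 1)) * v' r \<partial>lebesgue)"
    by (rule nn_integral_polar_product[OF u(1) m])
  also have "(\<integral>\<^sup>+r\<in>{0<..}. ennreal (r ^ (CARD('n) - 1)) * v' r \<partial>lebesgue) =
      (\<integral>\<^sup>+r\<in>{\<epsilon><..}. v r * ennreal (inverse r) \<partial>lebesgue)"
  proof (rule nn_integral_cong)
    fix r :: real
    have "ennreal (r ^ (CARD('n) - 1)) * ennreal (inverse (r ^ CARD('n))) = ennreal (inverse r)" if "r > 0"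
    proof -
      have "r ^ CARD('n) = r ^ (CARD('n) - 1) * r"
        using power_minus_mult[of "CARD('n)" r] by simp
      then show ?thesis using that by (simp flip: ennreal_mult)
    qed
    then have "ennreal (r ^ (CARD('n) - 1)) * (ennreal (inverse (r ^ CARD('n))) * v r) = ennreal (inverse r) * v r"
      if "r > 0" using that by (simp only: mult.assoc[symmetric])
    then show "ennreal (r ^ (CARD('n) - 1)) * v' r * indicator {0<..} r = v r * ennreal (inverse r) * indicator {\<epsilon><..} r"
      using \<open>\<epsilon> > 0\<close> by (cases "r > \<epsilon>") (simp_all add: v'_def mult.commute[of "v r"])
  qed
  finally show ?thesis using u(2) fin by (auto simp: ennreal_mult_less_top)
qed

section \<open>Dilates of the star-shaped set, and reduction to absolute convergence\<close>

lemma pos_homogeneous0_sphere_dir: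
  "pos_homogeneous0 \<Omega> \<Longrightarrow> y \<noteq> 0 \<Longrightarrow> \<Omega> (sphere_dir y) = \<Omega> y"
  unfolding pos_homogeneous0_def sphere_dir_def by simp

text \<open>Membership in tS reads |y|/t \<le> |\<Omega>(y)|^(1/n) by homogeneity; taking n-th
  powers turns it into a superlevel condition for |\<Omega>(y)| / |y|^n. This links the star-shaped
  set to the layers of the weight.\<close>

lemma mem_A_dom_iff:
  fixes \<Omega> :: "real^'n \<Rightarrow> complex"
  assumes hom: "pos_homogeneous0 \<Omega>" and "t > 0" "\<epsilon> > 0"
  shows "y \<in> A_dom \<Omega> \<epsilon> t \<longleftrightarrow>
    \<epsilon> \<le> norm y \<and> 1 \<le> t ^ CARD('n) * (cmod (\<Omega> (sphere_dir y)) / norm y ^ CARD('n))"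
proof (cases "\<epsilon> \<le> norm y")
  case True
  let ?n = "CARD('n)"
  have y: "norm y > 0" "y \<noteq> 0" using True \<open>\<epsilon> > 0\<close> by auto
  let ?c = "cmod (\<Omega> (sphere_dir y))"
  have "y \<in> (\<lambda>x. t *\<^sub>R x) ` star_set \<Omega> \<longleftrightarrow> inverse t *\<^sub>R y \<in> star_set \<Omega>"
  proof
    assume "inverse t *\<^sub>R y \<in> star_set \<Omega>"
    then show "y \<in> (\<lambda>x. t *\<^sub>R x) ` star_set \<Omega>"
      using \<open>t > 0\<close> by (intro image_eqI[of _ _ "inverse t *\<^sub>R y"]) auto
  qed (use \<open>t > 0\<close> in auto)
  also have "\<Omega> (inverse t *\<^sub>R y) = \<Omega> (sphere_dir y)"
    using hom y \<open>t > 0\<close> pos_homogeneous0_sphere_dir[OF hom, of y] unfolding pos_homogeneous0_def by simp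
  then have "inverse t *\<^sub>R y \<in> star_set \<Omega> \<longleftrightarrow> norm y / t \<le> ?c powr (1 / ?n)"
    using \<open>t > 0\<close> by (simp add: star_set_def radius_fun_def divide_inverse mult.commute)
  also have "\<dots> \<longleftrightarrow> (norm y / t) ^ ?n \<le> ?c"
  \<comment> \<open>Where \<Omega> vanishes both inequalities fail, because |y|/t is
    positive.\<close>
  proof (cases "?c = 0")
    case True
    moreover have "0 < norm y / t" using y \<open>t > 0\<close> by simp
    moreover have "0 < (norm y / t) ^ ?n" using calculation(2) by (rule zero_less_power)
    ultimately show ?thesis by (simp only: powr_0 flip: not_less)
  next
    case False
    then have "?c powr (1 / ?n) = root ?n ?c" by (simp add: root_powr_inverse)
    moreover have "norm y / t = root ?n ((norm y / t) ^ ?n)"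
      using \<open>t > 0\<close> by (subst real_root_power_cancel) auto
    ultimately show ?thesis by (metis real_root_le_iff zero_less_card_finite)
  qed
  also have "\<dots> \<longleftrightarrow> 1 \<le> t ^ ?n * (?c / norm y ^ ?n)"
    using y \<open>t > 0\<close> by (simp add: power_divide field_simps)
  finally show ?thesis using True by (simp add: A_dom_def)
qed (simp add: A_dom_def)

lemma measurable_extend_by_zero:
  assumes "h \<in> borel_measurable (lebesgue_on {0<..})"
  shows "(\<lambda>r::real. if r > 0 then h r else (0::complex)) \<in> borel_measurable lebesgue"
proof -
  have "(\<lambda>r. indicat_real {0<..} r *\<^sub>R h r) \<in> borel_measurable lebesgue"
    using assms by (subst (asm) borel_measurable_restrict_space_iff) auto
  also have "(\<lambda>r. indicat_real {0<..} r *\<^sub>R h r) = (\<lambda>r. if r > 0 then h r else 0)"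
    by (auto simp: indicator_def)
  finally show ?thesis .
qed

text \<open>Reduces all four claims at x to the finiteness of one integral, so that only absolute
  convergence of T is left for the two settings of the theorem.\<close>

lemma representation_atI:
  fixes \<Omega> :: "real^'n \<Rightarrow> complex"
  assumes \<Omega>: "\<Omega> \<in> borel_measurable surface_measure" and hom: "pos_homogeneous0 \<Omega>"
    and h: "h \<in> borel_measurable (lebesgue_on {0<..})" and f: "f \<in> borel_measurable lebesgue"
    and "\<epsilon> > 0"
    and fin: "(\<integral>\<^sup>+y\<in>{y. \<epsilon> < norm y}. ennreal (cmod (T_integrand \<Omega> h f x y)) \<partial>lebesgue) < \<infinity>"
  shows "representation_at \<Omega> h \<epsilon> f x"
proof -
  let ?n = "CARD('n)"
  define h' where "h' r = (if r > 0 then h r else 0)" for r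
  have h'm: "h' \<in> borel_measurable lebesgue"
    unfolding h'_def by (rule measurable_extend_by_zero[OF h])
  have [measurable]: "(\<lambda>y. \<Omega> (sphere_dir y)) \<in> borel_measurable lebesgue"
      "(\<lambda>y::real^'n. h' (norm y)) \<in> borel_measurable lebesgue" "(\<lambda>y. f (x - y)) \<in> borel_measurable lebesgue"
    by (rule measurable_compose[OF measurable_sphere_dir_surface \<Omega>],
        rule measurable_compose[OF measurable_norm_lebesgue h'm],
        rule measurable_compose[OF measurable_reflect_lebesgue f])
  have [measurable]: "(\<lambda>y::real^'n. norm y) \<in> borel_measurable lebesgue"
    by (intro measurable_completion) simp
  \<comment> \<open>The cut-off |y| > \<epsilon> goes into the weight, so that every superlevel set
    of \<open>w\<close> used below lies outside the closed ball of radius \<epsilon>.\<close>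
  define w where "w y = (if \<epsilon> < norm y then cmod (\<Omega> (sphere_dir y)) / norm y ^ ?n else 0)" for y :: "real^'n"
  define g where "g y = f (x - y) * h' (norm y) * sgn (\<Omega> (sphere_dir y))" for y
  have w0: "w y \<ge> 0" for y by (simp add: w_def)
  have [measurable]: "w \<in> borel_measurable lebesgue" unfolding w_def by measurable
  have sgn_m: "(sgn :: complex \<Rightarrow> complex) \<in> borel_measurable borel"
    unfolding sgn_div_norm[abs_def] by measurable
  have [measurable]: "g \<in> borel_measurable lebesgue"
    unfolding g_def by (intro borel_measurable_times measurable_compose[OF _ sgn_m]; measurable)
  have T_eq: "indicat_real (T_dom \<epsilon>) y *\<^sub>R T_integrand \<Omega> h f x y = of_real (w y) * g y" for y
  proof (cases "\<epsilon> < norm y")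
    case True
    then have "y \<noteq> 0" "norm y > 0" using \<open>\<epsilon> > 0\<close> by auto
    moreover have "z = of_real (cmod z) * sgn z" for z :: complex
      by (cases "z = 0") (simp_all add: sgn_div_norm scaleR_conv_of_real)
    from this[of "\<Omega> y"] have "T_integrand \<Omega> h f x y = of_real (w y) * g y"
      using True calculation pos_homogeneous0_sphere_dir[OF hom, of y]
      by (simp add: T_integrand_def w_def g_def h'_def mult_ac)
    ultimately show ?thesis using True by (simp add: T_dom_def)
  qed (simp add: T_dom_def w_def)
  have int: "integrable lebesgue (\<lambda>y. of_real (w y) * g y)"
  proof (rule integrableI_bounded)
    have "(\<integral>\<^sup>+y. ennreal (norm (of_real (w y) * g y)) \<partial>lebesgue) =
        (\<integral>\<^sup>+y\<in>{y. \<epsilon> < norm y}. ennreal (cmod (T_integrand \<Omega> h f x y)) \<partial>lebesgue)"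
      by (intro nn_integral_cong) (simp flip: T_eq add: indicator_def T_dom_def)
    then show "(\<integral>\<^sup>+y. ennreal (norm (of_real (w y) * g y)) \<partial>lebesgue) < \<infinity>"
      using fin by simp
  qed measurable
  note layers = sigma_finite_lebesgue \<open>w \<in> borel_measurable lebesgue\<close> w0 \<open>g \<in> borel_measurable lebesgue\<close> int
    zero_less_card_finite[where 'a='n]
  let ?L = "\<lambda>t. {y \<in> space lebesgue. 1 \<le> t ^ ?n * w y}"
  have A_eq: "indicat_real (A_dom \<Omega> \<epsilon> t) y *\<^sub>R A_integrand \<Omega> h f x y =
      (if \<epsilon> \<le> norm y \<and> 1 \<le> t ^ ?n * (cmod (\<Omega> (sphere_dir y)) / norm y ^ ?n) then g y else 0)"
    if "t > 0" for t y
    using mem_A_dom_iff[OF hom that \<open>\<epsilon> > 0\<close>, of y] pos_homogeneous0_sphere_dir[OF hom, of y] \<open>\<epsilon> > 0\<close>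
    by (auto simp: indicator_def A_integrand_def g_def h'_def)
  have A_meas: "(\<lambda>y. indicat_real (A_dom \<Omega> \<epsilon> t) y *\<^sub>R A_integrand \<Omega> h f x y) \<in> borel_measurable lebesgue"
    if "t > 0" for t
    unfolding A_eq[OF that] by measurable
  have A_AE: "AE y in lebesgue. indicat_real (?L t) y *\<^sub>R g y =
      indicat_real (A_dom \<Omega> \<epsilon> t) y *\<^sub>R A_integrand \<Omega> h f x y" if t: "t > 0" for t
  proof -
    \<comment> \<open>\<open>T_dom\<close> excludes the sphere |y| = \<epsilon>, whereas
      \<open>A_dom\<close> removes only the open ball. The two conditions differ on this sphere
      alone, a null set.\<close>
    have "AE y in lebesgue. norm (y :: real^'n) \<noteq> \<epsilon>"
      using AE_lborel_singleton[of \<epsilon>] by (intro AE_lebesgue_norm AE_completion)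
    then show ?thesis
      unfolding A_eq[OF t] by eventually_elim (auto simp: w_def indicator_def)
  qed
  have A_int: "set_integrable lebesgue (A_dom \<Omega> \<epsilon> t) (A_integrand \<Omega> h f x)" if "t > 0" for t
    using integrable_superlevel[OF layers that] A_meas[OF that] A_AE[OF that]
    unfolding set_integrable_def by (rule integrable_cong_AE_imp)
  have A_op: "1 / of_real (t ^ ?n) * (LINT y:?L t|lebesgue. g y) / of_real t = A_op \<Omega> h \<epsilon> t f x / of_real t"
    if "t > 0" for t
  proof -
    have "(LINT y:?L t|lebesgue. g y) = (LINT y:A_dom \<Omega> \<epsilon> t|lebesgue. A_integrand \<Omega> h f x y)"
      unfolding set_lebesgue_integral_def
      using A_meas[OF that] A_AE[OF that] by (intro integral_cong_AE) auto
    then show ?thesis by (simp add: A_op_def)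
  qed
  show ?thesis
    unfolding representation_at_def
  proof (intro conjI allI impI)
    show "set_integrable lebesgue (T_dom \<epsilon>) (T_integrand \<Omega> h f x)"
      unfolding set_integrable_def T_eq by (rule int)
    show "set_integrable lebesgue {0<..} (\<lambda>t. A_op \<Omega> h \<epsilon> t f x / of_real t)"
      using integrable_layers[OF layers] A_op
      by (subst set_integrable_cong[OF refl]) auto
    have "T_op \<Omega> h \<epsilon> f x = (\<integral>y. of_real (w y) * g y \<partial>lebesgue)"
      unfolding T_op_def set_lebesgue_integral_def T_eq ..
    also have "\<dots> = of_nat ?n * (LINT t:{0<..}|lebesgue.
        1 / of_real (t ^ ?n) * (LINT y:?L t|lebesgue. g y) / of_real t)"
      by (rule integral_layers[OF layers])
    also have "(LINT t:{0<..}|lebesgue. 1 / of_real (t ^ ?n) * (LINT y:?L t|lebesgue. g y) / of_real t) =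
        (LINT t:{0<..}|lebesgue. A_op \<Omega> h \<epsilon> t f x / of_real t)"
      using A_op by (intro set_lebesgue_integral_cong) auto
    finally show "T_op \<Omega> h \<epsilon> f x = of_nat ?n * (LINT t:{0<..}|lebesgue. A_op \<Omega> h \<epsilon> t f x / of_real t)" .
  qed (rule A_int)
qed

section \<open>Absolute convergence under the two sets of hypotheses\<close>

lemma conjugate_exponent_gt_1:
  fixes p p' :: real
  assumes "1 < p" "1 / p + 1 / p' = 1"
  shows "1 < p'"
proof -
  have "0 < 1 / p" "1 / p < 1" using assms(1) by simp_all
  then have "0 < 1 / p'" "1 / p' < 1" using assms(2) by linarith+
  then show ?thesis by (simp add: divide_less_eq_1)
qed

text \<open>With \<open>s = |y|\<close>, \<open>a = |h(s)|\<close> and \<open>b = |f(x - y)|\<close> the weight is chosen such that, against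
  \<open>|\<Omega>(y)| / s^n\<close>, the first term is radial and the second one is the directional potential of
  \<open>|f|^p\<close>.\<close>

lemma weighted_Young:
  fixes a b s p p' :: real
  assumes "1 < p" "1 / p + 1 / p' = 1" "a \<ge> 0" "b \<ge> 0" "s > 0"
  shows "a * b \<le> a powr p' * s powr (1 - p') + b powr p * s"
proof -
  have p': "1 < p'" using assms(1,2) by (rule conjugate_exponent_gt_1)
  have e: "- p' / p = 1 - p'"
    using assms p' by (simp add: field_simps)
  \<comment> \<open>Young's inequality is applied after inserting s^(1/p) s^(-1/p) = 1; the exponent
    -p'/p equals 1 - p' by conjugacy, and the factors 1/p and 1/p' are dropped at the end.\<close>
  have "a * b = (b * s powr (1 / p)) * (a * s powr (- 1 / p))"
    using \<open>s > 0\<close> by (simp add: powr_minus)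
  also have "\<dots> \<le> (b * s powr (1 / p)) powr p / p + (a * s powr (- 1 / p)) powr p' / p'"
    using assms p' by (intro Youngs_inequality) auto
  also have "(b * s powr (1 / p)) powr p = b powr p * s"
    using assms by (simp add: powr_mult powr_powr)
  also have "(a * s powr (- 1 / p)) powr p' = a powr p' * s powr (1 - p')"
    using assms by (simp add: powr_mult powr_powr flip: e)
  also have "b powr p * s / p \<le> b powr p * s"
    using assms divide_left_mono[of 1 p "b powr p * s"] by simp
  also have "a powr p' * s powr (1 - p') / p' \<le> a powr p' * s powr (1 - p')"
    using p' divide_left_mono[of 1 p' "a powr p' * s powr (1 - p')"] by simp
  finally show ?thesis by simp
qed

text \<open>Feeds the class H(\<sigma>) into the dyadic bound. It serves with \<sigma> = q = p' for
  f in L^p, and with \<sigma> = 1, q = 2 for bounded f of compact support.\<close>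

lemma H_class_dyadic:
  assumes h: "h \<in> H_class \<sigma>" and "\<epsilon> > 0" "q > 1"
  defines "v \<equiv> \<lambda>r. ennreal (cmod (if r > 0 then h r else 0) powr \<sigma>)"
  shows "v \<in> borel_measurable lebesgue"
    and "(\<integral>\<^sup>+r\<in>{\<epsilon><..}. v r * ennreal (r powr (- q)) \<partial>lebesgue) < \<infinity>"
proof -
  have [measurable]: "(\<lambda>r::real. if r > 0 then h r else (0::complex)) \<in> borel_measurable lebesgue"
    using h by (intro measurable_extend_by_zero) (simp add: H_class_def)
  show m: "v \<in> borel_measurable lebesgue"
    unfolding v_def by measurable
  obtain C where C: "C > 0"
    "\<And>R. R > 0 \<Longrightarrow> (\<integral>\<^sup>+ r\<in>{R..2*R}. ennreal (cmod (h r) powr \<sigma>) \<partial>lebesgue) \<le> ennreal (C * R)"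
    using h by (auto simp: H_class_def)
  have "(\<integral>\<^sup>+r\<in>{R..2*R}. v r \<partial>lebesgue) \<le> ennreal (C * R)" if "R > 0" for R
  proof -
    have "(\<integral>\<^sup>+r\<in>{R..2*R}. v r \<partial>lebesgue) = (\<integral>\<^sup>+ r\<in>{R..2*R}. ennreal (cmod (h r) powr \<sigma>) \<partial>lebesgue)"
      using that by (intro nn_integral_cong) (auto simp: v_def indicator_def)
    then show ?thesis using C(2)[OF that] by simp
  qed
  then show "(\<integral>\<^sup>+r\<in>{\<epsilon><..}. v r * ennreal (r powr (- q)) \<partial>lebesgue) < \<infinity>"
    using m assms C(1) by (intro nn_integral_dyadic_bound[of _ C]) auto
qed

text \<open>The complement of the support is a union of possibly uncountably many open sets on which
  f vanishes almost everywhere; by Lindelof countably many of them suffice.\<close>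

lemma AE_zero_outside_ess_support: "AE x in lebesgue. x \<notin> ess_support f \<longrightarrow> f x = 0"
proof -
  let ?\<U> = "{U. open U \<and> (AE x in lebesgue. x \<in> U \<longrightarrow> f x = 0)}"
  obtain \<V> where \<V>: "\<V> \<subseteq> ?\<U>" "countable \<V>" "\<Union>\<V> = \<Union>?\<U>"
    using Lindelof[of ?\<U>] by auto
  have "AE x in lebesgue. \<forall>U\<in>\<V>. x \<in> U \<longrightarrow> f x = 0"
    using \<V> by (subst AE_ball_countable) auto
  then show ?thesis
  proof eventually_elim
    case (elim x)
    then show ?case using \<V>(3) unfolding ess_support_def by blast
  qed
qed

lemma AE_T_integrand_integrable:
  fixes \<Omega> :: "real^'n \<Rightarrow> complex"
  assumes \<Omega>: "integrable surface_measure \<Omega>" and hom: "pos_homogeneous0 \<Omega>"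
    and p: "1 < p" "1 / p + 1 / p' = 1" and h: "h \<in> H_class p'" and f: "f \<in> Lp_class p" and "\<epsilon> > 0"
  shows "AE x in lebesgue.
    (\<integral>\<^sup>+y\<in>{y. \<epsilon> < norm y}. ennreal (cmod (T_integrand \<Omega> h f x y)) \<partial>lebesgue) < \<infinity>"
proof -
  let ?n = "CARD('n)"
  have p': "p' > 1" using p by (rule conjugate_exponent_gt_1)
  define u where "u \<theta> = ennreal (cmod (\<Omega> \<theta>))" for \<theta>
  have u: "u \<in> borel_measurable surface_measure" "(\<integral>\<^sup>+\<theta>. u \<theta> \<partial>surface_measure) < \<infinity>"
    using \<Omega> unfolding u_def by (auto simp: integrable_iff_bounded)
  define F where "F y = ennreal (cmod (f y) powr p)" for y
  have fm: "f \<in> borel_measurable lebesgue" using f by (simp add: Lp_class_def)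
  have Fm: "F \<in> borel_measurable lebesgue" unfolding F_def using fm by measurable
  have "(\<integral>\<^sup>+y. F y \<partial>lebesgue) < \<infinity>"
    using f by (auto simp: F_def Lp_class_def integrable_iff_bounded)
  note potential = AE_finite_directional_potential[OF u Fm this]
  define v where "v r = ennreal (cmod (if r > 0 then h r else 0) powr p')" for r
  have v: "v \<in> borel_measurable lebesgue"
      "(\<integral>\<^sup>+r\<in>{\<epsilon><..}. v r * ennreal (r powr (- p')) \<partial>lebesgue) < \<infinity>"
    unfolding v_def using H_class_dyadic[OF h \<open>\<epsilon> > 0\<close> p'] by auto
  \<comment> \<open>Together with the remaining 1/r of the radial kernel, the weight r^(1-p')
    becomes r^(-p'), which the dyadic bound handles with q = p' > 1.\<close>
  define V where "V r = v r * ennreal (r powr (1 - p'))" for r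
  have [measurable]: "V \<in> borel_measurable lebesgue"
    unfolding V_def by (rule borel_measurable_times_ennreal[OF v(1)], intro measurable_completion) measurable
  have "(\<integral>\<^sup>+r\<in>{\<epsilon><..}. V r * ennreal (inverse r) \<partial>lebesgue) =
      (\<integral>\<^sup>+r\<in>{\<epsilon><..}. v r * ennreal (r powr (- p')) \<partial>lebesgue)"
  proof (rule nn_integral_cong)
    fix r :: real
    have "ennreal (r powr (1 - p')) * ennreal (inverse r) = ennreal (r powr (- p'))" if "r > 0"
      using that by (simp add: powr_diff powr_minus field_simps flip: ennreal_mult)
    then show "V r * ennreal (inverse r) * indicator {\<epsilon><..} r = v r * ennreal (r powr (- p')) * indicator {\<epsilon><..} r"
      using \<open>\<epsilon> > 0\<close> by (cases "r > \<epsilon>") (simp_all add: V_def mult.assoc)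
  qed
  then have radial: "(\<integral>\<^sup>+y\<in>{y. \<epsilon> < norm y}. u (sphere_dir y) * ennreal (inverse (norm y ^ ?n)) * V (norm y) \<partial>lebesgue) < \<infinity>"
    using v(2) \<open>\<epsilon> > 0\<close> by (intro nn_integral_radial_kernel_finite[OF u]) auto
  have um: "(\<lambda>y. u (sphere_dir y)) \<in> borel_measurable lebesgue"
    by (rule measurable_compose[OF measurable_sphere_dir_surface u(1)])
  have Vm: "(\<lambda>y::real^'n. V (norm y)) \<in> borel_measurable lebesgue"
    by (rule measurable_compose[OF measurable_norm_lebesgue]) measurable
  let ?P = "\<lambda>y. u (sphere_dir y) * ennreal (inverse (norm y ^ ?n)) * V (norm y) * indicator {y. \<epsilon> < norm y} y"
  let ?Q = "\<lambda>x y. u (sphere_dir y) * ennreal (inverse (norm y ^ (?n - 1))) * F (x - y)"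
  have Pm: "?P \<in> borel_measurable lebesgue"
    by (rule borel_measurable_times_ennreal[OF borel_measurable_times_ennreal[OF
          borel_measurable_times_ennreal[OF um] Vm]]; intro measurable_completion; measurable)
  have Qm: "?Q x \<in> borel_measurable lebesgue" for x
    by (rule borel_measurable_times_ennreal[OF borel_measurable_times_ennreal[OF um]
          measurable_compose[OF measurable_reflect_lebesgue Fm]]; intro measurable_completion; measurable)
  \<comment> \<open>\<open>?P\<close> is radial apart from \<Omega> and has a finite integral
    independent of x. \<open>?Q\<close> is the directional potential of |f|^p, the only source of
    exceptional points x.\<close>
  have bound: "ennreal (cmod (T_integrand \<Omega> h f x y)) * indicator {y. \<epsilon> < norm y} y \<le> ?P y + ?Q x y" for x y
  proof (cases "\<epsilon> < norm y")
    case True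
    define s where "s = norm y"
    have s: "s > 0" "y \<noteq> 0" using True \<open>\<epsilon> > 0\<close> by (auto simp: s_def)
    define c where "c = cmod (\<Omega> y) * inverse (s ^ ?n)"
    have c: "c \<ge> 0" using s by (simp add: c_def)
    have pow: "inverse (s ^ ?n) * s = inverse (s ^ (?n - 1))"
      using s power_minus_mult[of ?n s] by (simp add: field_simps)
    have "cmod (T_integrand \<Omega> h f x y) = c * (cmod (h s) * cmod (f (x - y)))"
      using s by (simp add: T_integrand_def norm_mult norm_divide norm_inverse norm_power c_def divide_inverse s_def)
    also have "\<dots> \<le> c * (cmod (h s) powr p' * s powr (1 - p') + cmod (f (x - y)) powr p * s)"
      using c s p by (intro mult_left_mono weighted_Young) auto
    also have "\<dots> = cmod (\<Omega> y) * inverse (s ^ ?n) * (cmod (h s) powr p' * s powr (1 - p')) +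
        cmod (\<Omega> y) * inverse (s ^ (?n - 1)) * cmod (f (x - y)) powr p"
      unfolding pow[symmetric] by (simp add: c_def algebra_simps)
    finally have "ennreal (cmod (T_integrand \<Omega> h f x y)) \<le>
        ennreal (cmod (\<Omega> y) * inverse (s ^ ?n) * (cmod (h s) powr p' * s powr (1 - p')) +
        cmod (\<Omega> y) * inverse (s ^ (?n - 1)) * cmod (f (x - y)) powr p)"
      by (rule ennreal_leI)
    also have "\<dots> = ?P y + ?Q x y"
      using s True pos_homogeneous0_sphere_dir[OF hom, of y]
      by (simp add: u_def F_def V_def v_def s_def ennreal_mult)
    finally show ?thesis using True by simp
  qed simp
  show ?thesis
    using potential
  proof eventually_elim
    case (elim x)
    have "(\<integral>\<^sup>+y\<in>{y. \<epsilon> < norm y}. ennreal (cmod (T_integrand \<Omega> h f x y)) \<partial>lebesgue) \<le>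
        (\<integral>\<^sup>+y. ?P y + ?Q x y \<partial>lebesgue)"
      by (intro nn_integral_mono bound)
    also have "\<dots> = (\<integral>\<^sup>+y. ?P y \<partial>lebesgue) + (\<integral>\<^sup>+y. ?Q x y \<partial>lebesgue)"
      by (rule nn_integral_add[OF Pm Qm])
    also have "\<dots> < \<infinity>" using radial elim by (simp add: less_top)
    finally show ?case .
  qed
qed

text \<open>For fixed x the factor f(x-y) is bounded for almost all y and vanishes for almost all y
  with |y| > L. What remains is an integral of |h| over a bounded range of radii, finite for every
  x.\<close>

lemma T_integrand_integrable_of_compact_support:
  fixes \<Omega> :: "real^'n \<Rightarrow> complex"
  assumes \<Omega>: "integrable surface_measure \<Omega>" and hom: "pos_homogeneous0 \<Omega>"
    and h: "h \<in> H_class 1" and f: "f \<in> Linf_class" "compact (ess_support f)" and "\<epsilon> > 0"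
  shows "(\<integral>\<^sup>+y\<in>{y. \<epsilon> < norm y}. ennreal (cmod (T_integrand \<Omega> h f x y)) \<partial>lebesgue) < \<infinity>"
proof -
  let ?n = "CARD('n)"
  define u where "u \<theta> = ennreal (cmod (\<Omega> \<theta>))" for \<theta>
  have u: "u \<in> borel_measurable surface_measure" "(\<integral>\<^sup>+\<theta>. u \<theta> \<partial>surface_measure) < \<infinity>"
    using \<Omega> unfolding u_def by (auto simp: integrable_iff_bounded)
  obtain B where "AE y in lebesgue. cmod (f y) \<le> B"
    using f(1) by (auto simp: Linf_class_def)
  then have B: "AE y in lebesgue. cmod (f y) \<le> max B 0" by eventually_elim simp
  obtain M where M: "\<And>y. y \<in> ess_support f \<Longrightarrow> norm y \<le> M"
    using compact_imp_bounded[OF f(2)] by (auto simp: bounded_iff)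
  \<comment> \<open>If x - y lies in the ball of radius M then |y| \<le> |x| + M. The maximum keeps
    \<open>L\<close> nonnegative even when the support is empty and \<open>M\<close> is
    negative.\<close>
  define L where "L = norm x + max M 0"
  have "AE y in lebesgue. cmod (f y) \<le> max B 0 * indicator (cball 0 M) y"
    using B AE_zero_outside_ess_support[of f]
    by eventually_elim (use M in \<open>auto simp: indicator_def\<close>)
  from AE_lebesgue_reflect[OF this, of x]
  have fb: "AE y in lebesgue. cmod (f (x - y)) \<le> max B 0 * indicator {..L} (norm y)"
  proof eventually_elim
    case (elim y)
    show ?case
    proof (cases "norm (x - y) \<le> M")
      case True
      then have "norm y \<le> L"
        using norm_triangle_ineq4[of x "x - y"] by (simp add: L_def)
      then show ?thesis using elim True by simp
    qed (use elim in simp)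
  qed
  define v where "v r = ennreal (cmod (if r > 0 then h r else 0) powr 1)" for r
  have v: "v \<in> borel_measurable lebesgue"
      "(\<integral>\<^sup>+r\<in>{\<epsilon><..}. v r * ennreal (r powr (- 2)) \<partial>lebesgue) < \<infinity>"
    unfolding v_def using H_class_dyadic[OF h \<open>\<epsilon> > 0\<close>, of 2] by auto
  define V where "V r = v r * (ennreal (max B 0) * indicator {..L} r)" for r
  have [measurable]: "V \<in> borel_measurable lebesgue"
    unfolding V_def by (rule borel_measurable_times_ennreal[OF v(1)], intro measurable_completion) measurable
  have vm: "(\<lambda>r. v r * ennreal (r powr (- 2)) * indicator {\<epsilon><..} r) \<in> borel_measurable lebesgue"
    by (rule borel_measurable_times_ennreal[OF borel_measurable_times_ennreal[OF v(1)]]; intro measurable_completion; measurable)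
  have "(\<integral>\<^sup>+r\<in>{\<epsilon><..}. V r * ennreal (inverse r) \<partial>lebesgue) \<le>
      (\<integral>\<^sup>+r. ennreal (max B 0 * L) * (v r * ennreal (r powr (- 2)) * indicator {\<epsilon><..} r) \<partial>lebesgue)"
  proof (rule nn_integral_mono)
    fix r :: real
    \<comment> \<open>The weight 1/r alone is the borderline case q = 1 of the dyadic bound, where
      it fails. Since r \<le> L, one has 1/r \<le> L r^(-2), and q = 2 works.\<close>
    have "max B 0 * inverse r \<le> max B 0 * L * r powr (- 2)" if "0 < r" "r \<le> L"
    proof -
      have "inverse r = r * r powr (- 2)"
        using that by (simp add: powr_minus powr_numeral power2_eq_square field_simps)
      also have "\<dots> \<le> L * r powr (- 2)" using that by (intro mult_right_mono) auto
      finally show ?thesis by (simp add: mult.assoc mult_left_mono)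
    qed
    then have *: "ennreal (max B 0) * ennreal (inverse r) \<le> ennreal (max B 0 * L) * ennreal (r powr (- 2))"
      if "0 < r" "r \<le> L"
      using that by (simp add: ennreal_leI flip: ennreal_mult)
    show "V r * ennreal (inverse r) * indicator {\<epsilon><..} r \<le>
        ennreal (max B 0 * L) * (v r * ennreal (r powr (- 2)) * indicator {\<epsilon><..} r)"
    proof (cases "\<epsilon> < r \<and> r \<le> L")
      case True
      then have "v r * (ennreal (max B 0) * ennreal (inverse r)) \<le>
          v r * (ennreal (max B 0 * L) * ennreal (r powr (- 2)))"
        using * \<open>\<epsilon> > 0\<close> by (intro mult_left_mono) auto
      then show ?thesis using True by (simp add: V_def mult.assoc mult.left_commute)
    qed (auto simp: V_def indicator_def)
  qed
  also have "\<dots> = ennreal (max B 0 * L) * (\<integral>\<^sup>+r\<in>{\<epsilon><..}. v r * ennreal (r powr (- 2)) \<partial>lebesgue)"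
    by (rule nn_integral_cmult[OF vm])
  also have "\<dots> < \<infinity>" using v(2) by (auto simp: ennreal_mult_less_top)
  finally have radial: "(\<integral>\<^sup>+y\<in>{y. \<epsilon> < norm y}. u (sphere_dir y) * ennreal (inverse (norm y ^ ?n)) * V (norm y) \<partial>lebesgue) < \<infinity>"
    using \<open>\<epsilon> > 0\<close> by (intro nn_integral_radial_kernel_finite[OF u]) auto
  have "(\<integral>\<^sup>+y\<in>{y. \<epsilon> < norm y}. ennreal (cmod (T_integrand \<Omega> h f x y)) \<partial>lebesgue) \<le>
      (\<integral>\<^sup>+y\<in>{y. \<epsilon> < norm y}. u (sphere_dir y) * ennreal (inverse (norm y ^ ?n)) * V (norm y) \<partial>lebesgue)"
  proof (rule nn_integral_mono_AE)
    show "AE y in lebesgue. ennreal (cmod (T_integrand \<Omega> h f x y)) * indicator {y. \<epsilon> < norm y} y \<le>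
        u (sphere_dir y) * ennreal (inverse (norm y ^ ?n)) * V (norm y) * indicator {y. \<epsilon> < norm y} y"
      using fb
    proof eventually_elim
      case (elim y)
      show ?case
      proof (cases "\<epsilon> < norm y")
        case True
        then have y: "y \<noteq> 0" "norm y > 0" using \<open>\<epsilon> > 0\<close> by auto
        let ?c = "cmod (\<Omega> y) * inverse (norm y ^ ?n)"
        have "cmod (T_integrand \<Omega> h f x y) = ?c * (cmod (h (norm y)) * cmod (f (x - y)))"
          by (simp add: T_integrand_def norm_mult norm_divide norm_inverse norm_power divide_inverse)
        also have "\<dots> \<le> ?c * (cmod (h (norm y)) * (max B 0 * indicator {..L} (norm y)))"
          using elim by (intro mult_left_mono) auto
        finally have "ennreal (cmod (T_integrand \<Omega> h f x y)) \<le>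
            ennreal (?c * (cmod (h (norm y)) * (max B 0 * indicator {..L} (norm y))))"
          by (rule ennreal_leI)
        also have "\<dots> = u (sphere_dir y) * ennreal (inverse (norm y ^ ?n)) * V (norm y)"
          using y pos_homogeneous0_sphere_dir[OF hom, of y]
          by (simp add: u_def V_def v_def ennreal_mult ennreal_indicator)
        finally show ?thesis using True by simp
      qed simp
    qed
  qed
  also note radial
  finally show ?thesis .
qed

theorem theorem1p3:
  fixes \<Omega> :: "real^'n \<Rightarrow> complex"
  assumes "CARD('n) \<ge> 2"
    and "integrable surface_measure \<Omega>"
    and "pos_homogeneous0 \<Omega>"
  shows "(\<forall>p p' h f \<epsilon>. 1 < p \<and> 1 / p + 1 / p' = 1 \<and> h \<in> H_class p' \<and> f \<in> Lp_class p \<and> \<epsilon> > 0 \<longrightarrow>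
            (AE x in lebesgue. representation_at \<Omega> h \<epsilon> f x))
       \<and> (\<forall>h f \<epsilon>. h \<in> H_class 1 \<and> f \<in> Linf_class \<and> compact (ess_support f) \<and> \<epsilon> > 0 \<longrightarrow>
            (\<forall>x. representation_at \<Omega> h \<epsilon> f x))"
proof (intro conjI allI impI; elim conjE)
  have \<Omega>: "\<Omega> \<in> borel_measurable surface_measure" using assms(2) by simp
  note rep = representation_atI[OF \<Omega> assms(3)]
  fix h :: "real \<Rightarrow> complex" and f :: "real^'n \<Rightarrow> complex" and \<epsilon> :: real
  assume "\<epsilon> > 0"
  {
    fix p p' :: real
    assume p: "1 < p" "1 / p + 1 / p' = 1" and h: "h \<in> H_class p'" and f: "f \<in> Lp_class p"
    show "AE x in lebesgue. representation_at \<Omega> h \<epsilon> f x"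
      using AE_T_integrand_integrable[OF assms(2,3) p h f \<open>\<epsilon> > 0\<close>]
    proof eventually_elim
      case (elim x)
      then show ?case
        using h f \<open>\<epsilon> > 0\<close> by (intro rep) (auto simp: H_class_def Lp_class_def)
    qed
  }
  fix x
  assume h: "h \<in> H_class 1" and f: "f \<in> Linf_class" "compact (ess_support f)"
  show "representation_at \<Omega> h \<epsilon> f x"
    using h f(1) \<open>\<epsilon> > 0\<close> T_integrand_integrable_of_compact_support[OF assms(2,3) h f \<open>\<epsilon> > 0\<close>]
    by (intro rep) (auto simp: H_class_def Linf_class_def)
qed

end
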